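(* Let $F\subset\mathbb{P}^2_{\mathbb{C}}$ be the Fermat cubic $x^3+y^3+z^3=0$. Each line tangent to $F$ at a sextactic point intersects $F$ (residually) in a flex point. Moreover, through each flex point of $F$ there pass exactly three lines that are tangent to $F$ at sextactic points.
   Context: A point $P$ of a smooth plane curve $C$ of degree at least $3$ is called sextactic if there exists an irreducible conic whose intersection multiplicity with $C$ at $P$ is at least $6$. A flex point of $C$ is a point at which the tangent line meets $C$ with multiplicity strictly bigger than $2$. If $P\in F$ is not a flex, the tangent line to $F$ at $P$ meets $F$ at $P$ with multiplicity $2$ and at exactly one further point, called the residual intersection point. Sextactic points of $F$ are not flexes. *)

theory Defs
  imports
    "HOL-Analysis.Analysis"
    "HOL-Computational_Algebra.Computational_Algebra"
    "HOL-Library.Extended_Nat"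
begin

section \<open>The complex projective plane\<close>

definition proj_rel :: "complex ^ 3 \<Rightarrow> complex ^ 3 \<Rightarrow> bool" where
  "proj_rel u v \<longleftrightarrow> u \<noteq> 0 \<and> v \<noteq> 0 \<and> (\<exists>c. u = c *s v)"

quotient_type proj_plane = "complex ^ 3" / partial: proj_rel
proof (rule part_equivpI)
  show "\<exists>v. proj_rel v v"
    unfolding proj_rel_def by (intro exI[of _ "1 :: complex ^ 3"]) (metis one_neq_zero vector_smult_lid)
  show "symp proj_rel"
  proof (rule sympI)
    fix u v assume *: "proj_rel u v"
    then obtain c where c: "u = c *s v" "u \<noteq> 0" "v \<noteq> 0" unfolding proj_rel_def by blast
    then have "c \<noteq> 0" by auto
    then have "v = inverse c *s u" using c by (simp add: vector_smult_assoc)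
    with c show "proj_rel v u" unfolding proj_rel_def by blast
  qed
  show "transp proj_rel"
    by (rule transpI) (auto simp: proj_rel_def vector_smult_assoc)
qed

text \<open>Homogeneous coordinates of a point, determined up to a nonzero scalar (the library's
  choice of a representative of the class).\<close>

abbreviation coords :: "proj_plane \<Rightarrow> complex ^ 3" where
  "coords \<equiv> rep_proj_plane"

lemma coords_nonzero: "coords P \<noteq> 0"
  using Quotient3_rep_reflp[OF Quotient3_proj_plane, of P] by (simp add: proj_rel_def)

lemma coords_abs:
  assumes "v \<noteq> 0"
  shows "\<exists>c. c \<noteq> 0 \<and> coords (abs_proj_plane v) = c *s v"
proof -
  have "proj_rel v v"
    using assms unfolding proj_rel_def by (metis vector_smult_lid)
  then have "proj_rel (coords (abs_proj_plane v)) v"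
    by (rule Quotient3_rep_abs[OF Quotient3_proj_plane])
  then show ?thesis unfolding proj_rel_def by fastforce
qed


section \<open>Ternary polynomials\<close>

text \<open>Polynomials in \<open>x, y, z\<close> over the complex numbers are elements of
  $((\mathbf{C}[x])[y])[z]$: the innermost variable is \<open>x\<close>, the outermost one is \<open>z\<close>.\<close>

type_synonym tpoly = "complex poly poly poly"

definition tconst :: "complex \<Rightarrow> tpoly" where "tconst c = [:[:[:c:]:]:]"
definition var_x :: tpoly where "var_x = [:[:[:0, 1:]:]:]"
definition var_y :: tpoly where "var_y = [:[:0, 1:]:]"
definition var_z :: tpoly where "var_z = [:0, 1:]"

definition tcoeff :: "tpoly \<Rightarrow> nat \<Rightarrow> nat \<Rightarrow> nat \<Rightarrow> complex" where
  "tcoeff F i j k = coeff (coeff (coeff F k) j) i"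

definition teval :: "tpoly \<Rightarrow> complex ^ 3 \<Rightarrow> complex" where
  "teval F v = poly (poly (poly F [:[:v $ 3:]:]) [:v $ 2:]) (v $ 1)"

definition homogeneous :: "nat \<Rightarrow> tpoly \<Rightarrow> bool" where
  "homogeneous d F \<longleftrightarrow> (\<forall>i j k. tcoeff F i j k \<noteq> 0 \<longrightarrow> i + j + k = d)"

definition d_x :: "tpoly \<Rightarrow> tpoly" where "d_x = map_poly (map_poly pderiv)"
definition d_y :: "tpoly \<Rightarrow> tpoly" where "d_y = map_poly pderiv"
definition d_z :: "tpoly \<Rightarrow> tpoly" where "d_z = pderiv"

lemma teval_simps [simp]:
  "teval (F + G) v = teval F v + teval G v"
  "teval (F - G) v = teval F v - teval G v"
  "teval (F * G) v = teval F v * teval G v"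
  "teval (F ^ n) v = teval F v ^ n"
  "teval (tconst c) v = c"
  "teval var_x v = v $ 1" "teval var_y v = v $ 2" "teval var_z v = v $ 3"
  "teval 0 v = 0" "teval 1 v = 1"
  by (simp_all add: teval_def tconst_def var_x_def var_y_def var_z_def)

lemma poly_as_sum: "degree p \<le> n \<Longrightarrow> poly p x = (\<Sum>i\<le>n. coeff p i * x ^ i)"
  for p :: "'a::comm_semiring_1 poly"
  unfolding poly_altdef
  by (rule sum.mono_neutral_left) (auto simp: coeff_eq_0)

lemma teval_as_sum:
  "\<exists>N. \<forall>v. teval F v = (\<Sum>k\<le>N. \<Sum>j\<le>N. \<Sum>i\<le>N. tcoeff F i j k * v $ 1 ^ i * v $ 2 ^ j * v $ 3 ^ k)"
proof -
  define A where "A = Max ((\<lambda>k. degree (coeff F k)) ` {..degree F})"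
  define B where "B = Max ((\<lambda>(k, j). degree (coeff (coeff F k) j)) ` ({..degree F} \<times> {..A}))"
  define N where "N = max (degree F) (max A B)"
  have A: "degree (coeff F k) \<le> A" for k
  proof (cases "k \<le> degree F")
    case True then show ?thesis unfolding A_def by (intro Max_ge) auto
  qed (simp add: coeff_eq_0)
  have B: "degree (coeff (coeff F k) j) \<le> B" for k j
  proof (cases "k \<le> degree F \<and> j \<le> A")
    case True then show ?thesis unfolding B_def by (intro Max_ge) auto
  next
    case False
    then have "k > degree F \<or> j > degree (coeff F k)" using A[of k] by linarith
    then show ?thesis by (auto simp: coeff_eq_0)
  qed
  have N: "degree F \<le> N" "degree (coeff F k) \<le> N" "degree (coeff (coeff F k) j) \<le> N" for k j
    using A[of k] B[of k j] by (auto simp: N_def)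
  have "teval F v = (\<Sum>k\<le>N. \<Sum>j\<le>N. \<Sum>i\<le>N. tcoeff F i j k * v $ 1 ^ i * v $ 2 ^ j * v $ 3 ^ k)" for v
  proof -
    have "teval F v = (\<Sum>k\<le>N. poly (poly (coeff F k) [:v $ 2:]) (v $ 1) * v $ 3 ^ k)"
      by (simp add: teval_def poly_as_sum[OF N(1)] poly_sum)
    also have "\<dots> = (\<Sum>k\<le>N. (\<Sum>j\<le>N. poly (coeff (coeff F k) j) (v $ 1) * v $ 2 ^ j) * v $ 3 ^ k)"
      by (simp add: poly_as_sum[OF N(2)] poly_sum)
    also have "\<dots> = (\<Sum>k\<le>N. (\<Sum>j\<le>N. (\<Sum>i\<le>N. tcoeff F i j k * v $ 1 ^ i) * v $ 2 ^ j) * v $ 3 ^ k)"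
      by (simp add: poly_as_sum[OF N(3)] tcoeff_def)
    finally show ?thesis by (simp add: sum_distrib_right)
  qed
  then show ?thesis by blast
qed

lemma teval_scale:
  assumes "homogeneous d F"
  shows "teval F (c *s v) = c ^ d * teval F v"
proof -
  obtain N where N: "\<And>v. teval F v =
      (\<Sum>k\<le>N. \<Sum>j\<le>N. \<Sum>i\<le>N. tcoeff F i j k * v $ 1 ^ i * v $ 2 ^ j * v $ 3 ^ k)"
    using teval_as_sum by blast
  have *: "tcoeff F i j k * (c *s v) $ 1 ^ i * (c *s v) $ 2 ^ j * (c *s v) $ 3 ^ k
      = c ^ d * (tcoeff F i j k * v $ 1 ^ i * v $ 2 ^ j * v $ 3 ^ k)" for i j k
  proof (cases "tcoeff F i j k = 0")
    case False
    then have "d = i + j + k" using assms unfolding homogeneous_def by auto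
    then show ?thesis by (simp add: power_mult_distrib power_add mult_ac)
  qed simp
  show ?thesis unfolding N by (simp only: * sum_distrib_left)
qed


section \<open>Plane curves and intersection multiplicity\<close>

text \<open>All notions below are meant for homogeneous polynomials, for which vanishing at a point does
  not depend on the choice of homogeneous coordinates (\<open>teval_scale\<close>).\<close>

definition vanishes_at :: "tpoly \<Rightarrow> proj_plane \<Rightarrow> bool" where
  "vanishes_at F P \<longleftrightarrow> teval F (coords P) = 0"

definition curve :: "tpoly \<Rightarrow> proj_plane set" where
  "curve F = {P. vanishes_at F P}"

definition smooth_curve :: "nat \<Rightarrow> tpoly \<Rightarrow> bool" where
  "smooth_curve d F \<longleftrightarrow> d > 0 \<and> homogeneous d F \<and>
     (\<forall>P \<in> curve F. \<not> (vanishes_at (d_x F) P \<and> vanishes_at (d_y F) P \<and> vanishes_at (d_z F) P))"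

text \<open>The local ring of the plane at \<open>P\<close>, inside the field of fractions of the polynomial ring:
  fractions of forms of equal degree whose denominator does not vanish at \<open>P\<close>. The forms
  \<open>F\<close> and \<open>G\<close> cut out the degree zero part of the localisation at \<open>P\<close> of the
  homogeneous ideal $(F, G)$, that is, the ideal generated by the local equations of the
  two curves.\<close>

definition local_ring :: "proj_plane \<Rightarrow> tpoly fract set" where
  "local_ring P = {Fract A B | A B d. homogeneous d A \<and> homogeneous d B \<and> \<not> vanishes_at B P}"

definition local_ideal :: "proj_plane \<Rightarrow> tpoly \<Rightarrow> tpoly \<Rightarrow> tpoly fract set" where
  "local_ideal P F G = {Fract A B | A B d. homogeneous d A \<and> homogeneous d B \<and> \<not> vanishes_at B P
     \<and> (\<exists>U V. A = U * F + V * G)}"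

definition indep_mod :: "tpoly fract set \<Rightarrow> tpoly fract set \<Rightarrow> bool" where
  "indep_mod J B \<longleftrightarrow> (\<forall>a. (\<Sum>b\<in>B. Fract (tconst (a b)) 1 * b) \<in> J \<longrightarrow> (\<forall>b\<in>B. a b = 0))"

text \<open>The dimension over the complex numbers of the quotient of the local ring by the ideal of
  the two curves, as the supremum of the cardinalities of linearly independent families;
  it is \<open>\<infinity>\<close> if the curves have a common component through \<open>P\<close>.\<close>

definition int_mult :: "proj_plane \<Rightarrow> tpoly \<Rightarrow> tpoly \<Rightarrow> enat" where
  "int_mult P F G =
     (SUP B \<in> {B. finite B \<and> B \<subseteq> local_ring P \<and> indep_mod (local_ideal P F G) B}. enat (card B))"


section \<open>Tangent lines, flexes and sextactic points\<close>

text \<open>\<open>tangent_form F P\<close> is a linear form defining the tangent line to \<open>F\<close> at a smooth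
  point \<open>P\<close> of the curve; another choice of coordinates of \<open>P\<close> rescales it.\<close>

definition tangent_form :: "tpoly \<Rightarrow> proj_plane \<Rightarrow> tpoly" where
  "tangent_form F P = tconst (teval (d_x F) (coords P)) * var_x
     + tconst (teval (d_y F) (coords P)) * var_y + tconst (teval (d_z F) (coords P)) * var_z"

definition tangent_line :: "tpoly \<Rightarrow> proj_plane \<Rightarrow> proj_plane set" where
  "tangent_line F P = curve (tangent_form F P)"

definition flex :: "tpoly \<Rightarrow> proj_plane \<Rightarrow> bool" where
  "flex F P \<longleftrightarrow> P \<in> curve F \<and> int_mult P F (tangent_form F P) > 2"

definition irreducible_conic :: "tpoly \<Rightarrow> bool" where
  "irreducible_conic Q \<longleftrightarrow> homogeneous 2 Q \<and> irreducible Q"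

text \<open>For \<open>F\<close> defining a smooth curve of degree at least \<open>3\<close>.\<close>

definition sextactic :: "tpoly \<Rightarrow> proj_plane \<Rightarrow> bool" where
  "sextactic F P \<longleftrightarrow> P \<in> curve F \<and> (\<exists>Q. irreducible_conic Q \<and> int_mult P F Q \<ge> 6)"

text \<open>For a cubic \<open>F\<close>: \<open>R\<close> is the one further point in which the tangent line at \<open>P\<close>
  meets the curve.\<close>

definition residual_point :: "tpoly \<Rightarrow> proj_plane \<Rightarrow> proj_plane \<Rightarrow> bool" where
  "residual_point F P R \<longleftrightarrow> R \<noteq> P \<and> curve F \<inter> tangent_line F P = {P, R}"

definition fermat_cubic :: tpoly where
  "fermat_cubic = var_x ^ 3 + var_y ^ 3 + var_z ^ 3"

lemma fermat_cubic_explicit: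
  "fermat_cubic = [:[:[:0, 0, 0, 1:], 0, 0, 1:], 0, 0, 1:]"
  by (simp add: fermat_cubic_def var_x_def var_y_def var_z_def power3_eq_cube one_pCons)

lemma fermat_cubic_derivs:
  "d_x fermat_cubic = tconst 3 * var_x ^ 2"
  "d_y fermat_cubic = tconst 3 * var_y ^ 2"
  "d_z fermat_cubic = tconst 3 * var_z ^ 2"
  unfolding d_x_def d_y_def d_z_def fermat_cubic_explicit
  by (simp_all add: tconst_def var_x_def var_y_def var_z_def map_poly_pCons pderiv_pCons
      power2_eq_square one_pCons numeral_poly)

lemma smooth_fermat_cubic: "smooth_curve 3 fermat_cubic"
proof -
  have "homogeneous 3 fermat_cubic"
    unfolding homogeneous_def tcoeff_def fermat_cubic_explicit
    by (auto simp: coeff_pCons split: nat.splits)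
  moreover have "coords P \<noteq> 0" for P by (rule coords_nonzero)
  ultimately show ?thesis
    unfolding smooth_curve_def vanishes_at_def fermat_cubic_derivs
    by (auto simp: vec_eq_iff forall_3)
qed

end

theory Submission
  imports Defs
begin

text \<open>
  Why the theorem holds. In the group law of \<open>F\<close> with a flex as origin, the flexes are the points
  with \<open>3P = 0\<close> and the sextactic points are those with \<open>6P = 0\<close> and \<open>3P \<noteq> 0\<close>; the residual point
  of \<open>P\<close> is \<open>-2P\<close>, which is a flex when \<open>P\<close> is sextactic, and \<open>2P = -Q\<close> has four solutions for a
  flex \<open>Q\<close>, namely \<open>Q\<close> itself and three sextactic points. For the Fermat cubic both kinds of points
  have explicit coordinates, so the group law can be replaced by computation: the flexes are the
  points with a vanishing coordinate (\<open>flex_fermat_iff\<close>), and the sextactic points are those with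
  no vanishing coordinate and two coordinates that have equal cubes (\<open>sextactic_fermatD\<close>,
  \<open>sextactic_fermatI\<close>). With \<open>P = (a, b, 1)\<close>, \<open>b\<^sup>3 = 1\<close> and \<open>a\<^sup>3 = -2\<close>, the residual point is the
  flex \<open>(0, -b, 1)\<close>; conversely the sextactic points with tangent through the flex \<open>(0, r, 1)\<close> are
  \<open>(a, -r, 1)\<close> with \<open>a\<close> ranging over the three cube roots of \<open>-2\<close>.

  To obtain these descriptions one must compute intersection multiplicities, which are dimensions of
  quotients of local rings. The bridge is \<open>int_mult_ge_iff\<close>: if \<open>F\<close> is smooth at \<open>P\<close> and \<open>\<gamma>\<close> is a
  polynomial arc through \<open>P\<close> with nonzero velocity along which \<open>F\<close> vanishes to order \<open>N\<close> in the
  parameter \<open>t\<close>, then for \<open>n \<le> N\<close> the multiplicity of \<open>F\<close> and \<open>G\<close> at \<open>P\<close> is at least \<open>n\<close> exactly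
  if \<open>t\<^sup>n\<close> divides \<open>G\<close> along \<open>\<gamma>\<close>. The lower bound evaluates the powers of a uniformizer along the
  arc. The upper bound rests on the fact that, up to a unit and modulo \<open>F\<close>, a form that vanishes to
  order \<open>m\<close> along the arc is divisible by the \<open>m\<close>-th power of the uniformizer
  (\<open>factor_uniformizer\<close>).

  Along an explicit arc of contact order 6, a conic in coordinates adapted to the tangent line gives
  six linear equations for its six coefficients. They are solvable by an irreducible conic only if a
  certain determinant vanishes, and with \<open>A = a\<^sup>3\<close> that determinant is a multiple of
  \<open>(A - 1) (2 A + 1) (A + 2)\<close>; the three factors say that two of the three coordinates have equal
  cubes. For the converse, the osculating conic \<open>Q\<close> comes from an identity
  \<open>T\<^sup>3 + 3 M Q = 4 F\<close>, where \<open>T\<close> is the tangent at \<open>P\<close> and \<open>M\<close> the tangent at the residual flex: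
  along the curve, \<open>T\<close> vanishes to order 2 at \<open>P\<close> and \<open>M\<close> does not vanish there, so \<open>Q\<close> vanishes
  to order 6.
\<close>
section \<open>Ternary forms\<close>

text \<open>Indexing the variables by the coordinates lets every later argument be written for an arbitrary
  ordering \<open>i\<close>, \<open>j\<close>, \<open>k\<close> of the three coordinates, which takes the place of the symmetries of the
  Fermat cubic.\<close>
definition tvar :: "3 \<Rightarrow> tpoly" where
  "tvar i = (if i = 1 then var_x else if i = 2 then var_y else var_z)"

lemma teval_tvar [simp]: "teval (tvar i) v = v $ i"
  using exhaust_3[of i] by (auto simp: tvar_def)

lemma teval_sum: "teval (\<Sum>i\<in>S. f i) v = (\<Sum>i\<in>S. teval (f i) v)"
  by (induction S rule: infinite_finite_induct) auto

lemma poly_eqI_infinite: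
  fixes p q :: "'a :: idom poly"
  assumes "infinite S" "\<And>x. x \<in> S \<Longrightarrow> poly p x = poly q x"
  shows "p = q"
proof (rule ccontr)
  assume "p \<noteq> q"
  then have "finite {x. poly (p - q) x = 0}" by (intro poly_roots_finite) simp
  moreover have "S \<subseteq> {x. poly (p - q) x = 0}" using assms(2) by auto
  ultimately show False using assms(1) finite_subset by blast
qed

text \<open>The complex field is infinite, so identities between ternary polynomials can be checked
  pointwise. One variable is removed at a time: the constants form an infinite subset of each of the
  two coefficient rings.\<close>
lemma teval_eqI:
  assumes "\<And>v. teval A v = teval B v"
  shows "A = B"
proof (rule poly_eqI_infinite)
  show "infinite (range (\<lambda>z :: complex. [:[:z:]:]))"
    by (auto dest!: finite_imageD simp: inj_on_def infinite_UNIV_char_0)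
  fix C assume "C \<in> range (\<lambda>z :: complex. [:[:z:]:])"
  then obtain z where C: "C = [:[:z:]:]" by auto
  show "poly A C = poly B C"
  proof (rule poly_eqI_infinite)
    show "infinite (range (\<lambda>y :: complex. [:y:]))"
      by (auto dest!: finite_imageD simp: inj_on_def infinite_UNIV_char_0)
    fix D assume "D \<in> range (\<lambda>y :: complex. [:y:])"
    then obtain y where D: "D = [:y:]" by auto
    have "poly (poly (poly A C) D) x = poly (poly (poly B C) D) x" for x
      using assms[of "vector [x, y, z]"] by (simp add: teval_def C D)
    then show "poly (poly A C) D = poly (poly B C) D"
      by (simp add: poly_eq_poly_eq_iff[symmetric] fun_eq_iff)
  qed
qed

lemma tcoeff_simps [simp]:
  "tcoeff (A + B) i j k = tcoeff A i j k + tcoeff B i j k"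
  "tcoeff (A - B) i j k = tcoeff A i j k - tcoeff B i j k"
  "tcoeff 0 i j k = 0"
  by (simp_all add: tcoeff_def)

lemma homogeneous_0 [simp]: "homogeneous d 0"
  by (simp add: homogeneous_def)

lemma homogeneous_add: "homogeneous d A \<Longrightarrow> homogeneous d B \<Longrightarrow> homogeneous d (A + B)"
  unfolding homogeneous_def by (metis add.right_neutral tcoeff_simps(1))

lemma homogeneous_diff: "homogeneous d A \<Longrightarrow> homogeneous d B \<Longrightarrow> homogeneous d (A - B)"
  unfolding homogeneous_def by (metis diff_zero tcoeff_simps(2) add.right_neutral)

lemma homogeneous_tconst [simp]: "homogeneous 0 (tconst c)"
  by (auto simp: homogeneous_def tcoeff_def tconst_def coeff_pCons split: nat.splits)

lemma homogeneous_1 [simp]: "homogeneous 0 1"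
  using homogeneous_tconst[of 1] by (simp add: tconst_def one_pCons)

lemma homogeneous_tvar [simp]: "homogeneous 1 (tvar i)" "homogeneous (Suc 0) (tvar i)"
  by (auto simp: homogeneous_def tcoeff_def tvar_def var_x_def var_y_def var_z_def coeff_pCons
      one_pCons split: nat.splits)

lemma homogeneous_mult:
  assumes "homogeneous d A" "homogeneous e B"
  shows "homogeneous (d + e) (A * B)"
  unfolding homogeneous_def
proof (intro allI impI)
  fix i j k assume nz: "tcoeff (A * B) i j k \<noteq> 0"
  have "tcoeff (A * B) i j k =
     (\<Sum>k'\<le>k. \<Sum>j'\<le>j. \<Sum>i'\<le>i. tcoeff A i' j' k' * tcoeff B (i - i') (j - j') (k - k'))"
    by (simp add: tcoeff_def coeff_mult coeff_sum)
  with nz obtain k' where k': "k' \<le> k"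
    "(\<Sum>j'\<le>j. \<Sum>i'\<le>i. tcoeff A i' j' k' * tcoeff B (i - i') (j - j') (k - k')) \<noteq> 0"
    by (metis (no_types, lifting) sum.neutral atMost_iff)
  then obtain j' where j': "j' \<le> j"
    "(\<Sum>i'\<le>i. tcoeff A i' j' k' * tcoeff B (i - i') (j - j') (k - k')) \<noteq> 0"
    by (metis (no_types, lifting) sum.neutral atMost_iff)
  then obtain i' where i': "i' \<le> i" "tcoeff A i' j' k' * tcoeff B (i - i') (j - j') (k - k') \<noteq> 0"
    by (metis (no_types, lifting) sum.neutral atMost_iff)
  then have "i' + j' + k' = d" "(i - i') + (j - j') + (k - k') = e"
    using assms unfolding homogeneous_def by (metis mult_zero_left, metis mult_zero_right)
  with k' j' i' show "i + j + k = d + e" by linarith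
qed

lemma homogeneous_tconst_mult: "homogeneous d A \<Longrightarrow> homogeneous d (tconst c * A)"
  using homogeneous_mult[OF homogeneous_tconst] by fastforce

lemma homogeneous_power: "homogeneous d A \<Longrightarrow> homogeneous (n * d) (A ^ n)"
  by (induction n) (auto intro: homogeneous_mult)

text \<open>A form is a sum of monomials of its own degree, so the forms are generated by constants and
  variables with addition inside a degree and multiplication across degrees.\<close>
lemma homogeneous_induct [consumes 1, case_names zero add mult const var]:
  assumes "homogeneous d A"
    and "\<And>d. P d 0"
    and "\<And>d A B. P d A \<Longrightarrow> P d B \<Longrightarrow> P d (A + B)"
    and "\<And>d e A B. P d A \<Longrightarrow> P e B \<Longrightarrow> P (d + e) (A * B)"
    and "\<And>c. P 0 (tconst c)"
    and "\<And>i. P 1 (tvar i)"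
  shows "P d A"
proof -
  have pow: "P (n * e) (B ^ n)" if "P e B" for n e B
  proof (induction n)
    case 0 then show ?case using assms(5)[of 1] by (simp add: tconst_def one_pCons)
  next
    case (Suc n) then show ?case using assms(4)[OF that] by simp
  qed
  have sum: "P e (\<Sum>i\<in>S. f i)" if "\<And>i. i \<in> S \<Longrightarrow> P e (f i)" for e f and S :: "nat set"
    using that by (induction S rule: infinite_finite_induct) (auto intro: assms(2,3))
  obtain N where N: "\<And>v. teval A v =
      (\<Sum>k\<le>N. \<Sum>j\<le>N. \<Sum>i\<le>N. tcoeff A i j k * v $ 1 ^ i * v $ 2 ^ j * v $ 3 ^ k)"
    using teval_as_sum by blast
  define mono where "mono i j k = tconst (tcoeff A i j k) * tvar 1 ^ i * tvar 2 ^ j * tvar 3 ^ k" for i j k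
  have "A = (\<Sum>k\<le>N. \<Sum>j\<le>N. \<Sum>i\<le>N. mono i j k)"
    by (rule teval_eqI) (simp add: N teval_sum mono_def)
  moreover have "P d (mono i j k)" for i j k
  proof (cases "tcoeff A i j k = 0")
    case True
    then have "mono i j k = 0" by (simp add: mono_def tconst_def)
    then show ?thesis using assms(2) by simp
  next
    case False
    then have "d = ((0 + i * 1) + j * 1) + k * 1" using assms(1) by (auto simp: homogeneous_def)
    then show ?thesis unfolding mono_def
      by (simp only:) (intro assms(4,5,6) pow)
  qed
  ultimately show ?thesis using sum by simp
qed

section \<open>Arcs and contact orders\<close>

definition arc_at :: "complex poly ^ 3 \<Rightarrow> complex \<Rightarrow> complex ^ 3" where
  "arc_at \<gamma> t = (\<chi> i. poly (\<gamma> $ i) t)"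

text \<open>The restriction of a polynomial to an arc. It is determined by its values, which makes its
  algebraic rules consequences of those of \<open>teval\<close>.\<close>
definition pull :: "complex poly ^ 3 \<Rightarrow> tpoly \<Rightarrow> complex poly" where
  "pull \<gamma> F = (SOME p. \<forall>t. poly p t = teval F (arc_at \<gamma> t))"

lemma poly_pull [simp]: "poly (pull \<gamma> F) t = teval F (arc_at \<gamma> t)"
proof -
  obtain N where N: "\<And>v. teval F v =
      (\<Sum>k\<le>N. \<Sum>j\<le>N. \<Sum>i\<le>N. tcoeff F i j k * v $ 1 ^ i * v $ 2 ^ j * v $ 3 ^ k)"
    using teval_as_sum by blast
  have "\<forall>t. poly (\<Sum>k\<le>N. \<Sum>j\<le>N. \<Sum>i\<le>N. [:tcoeff F i j k:] * \<gamma> $ 1 ^ i * \<gamma> $ 2 ^ j * \<gamma> $ 3 ^ k) t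
     = teval F (arc_at \<gamma> t)"
    by (simp add: N poly_sum arc_at_def mult.assoc)
  then show ?thesis unfolding pull_def by (rule someI2[where Q = "\<lambda>p. poly p t = _"]) simp
qed

lemma pull_eqI: "(\<And>t. teval F (arc_at \<gamma> t) = poly p t) \<Longrightarrow> pull \<gamma> F = p"
  by (simp add: poly_eq_poly_eq_iff[symmetric] fun_eq_iff)

lemma pull_simps [simp]:
  "pull \<gamma> (A + B) = pull \<gamma> A + pull \<gamma> B"
  "pull \<gamma> (A - B) = pull \<gamma> A - pull \<gamma> B"
  "pull \<gamma> (A * B) = pull \<gamma> A * pull \<gamma> B"
  "pull \<gamma> (A ^ n) = pull \<gamma> A ^ n"
  "pull \<gamma> (tconst c) = [:c:]"
  "pull \<gamma> (tvar i) = \<gamma> $ i"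
  "pull \<gamma> 0 = 0" "pull \<gamma> 1 = 1"
  by (auto intro!: pull_eqI simp: arc_at_def)

text \<open>A polynomial with nonzero constant term is a unit in the local ring at the origin.\<close>
lemma monom_dvd_cancel:
  fixes p q :: "complex poly"
  assumes "monom 1 n dvd p * q" "coeff q 0 \<noteq> 0"
  shows "monom 1 n dvd p"
proof -
  have "coeff p k = 0" if "k < n" for k
    using that
  proof (induction k rule: less_induct)
    case (less k)
    have "0 = coeff (p * q) k" using assms(1) less.prems by (simp add: monom_1_dvd_iff')
    also have "\<dots> = (\<Sum>i\<le>k. coeff p i * coeff q (k - i))" by (simp add: coeff_mult)
    also have "\<dots> = (\<Sum>i\<in>{k}. coeff p i * coeff q (k - i))"
      using less by (intro sum.mono_neutral_right) auto
    finally show ?case using assms(2) by simp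
  qed
  then show ?thesis by (simp add: monom_1_dvd_iff')
qed

text \<open>More than \<open>k\<close> vectors with \<open>k\<close> coordinates are linearly dependent. The induction eliminates the
  last coordinate with a pivot vector \<open>c\<close>.\<close>
lemma exists_linear_relation:
  fixes f :: "'b \<Rightarrow> nat \<Rightarrow> 'a :: field"
  assumes "finite B" "k < card B"
  shows "\<exists>a. (\<exists>b\<in>B. a b \<noteq> 0) \<and> (\<forall>i<k. (\<Sum>b\<in>B. a b * f b i) = 0)"
  using assms
proof (induction k arbitrary: B f)
  case 0
  then have "B \<noteq> {}" by auto
  then show ?case by (intro exI[of _ "\<lambda>_. 1"]) auto
next
  case (Suc k)
  show ?case
  proof (cases "\<forall>b\<in>B. f b k = 0")
    case True
    obtain a where a: "\<exists>b\<in>B. a b \<noteq> 0" "\<forall>i<k. (\<Sum>b\<in>B. a b * f b i) = 0"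
      using Suc.IH[of B f] Suc.prems by auto
    with True have "\<forall>i<Suc k. (\<Sum>b\<in>B. a b * f b i) = 0" by (auto simp: less_Suc_eq)
    with a show ?thesis by blast
  next
    case False
    then obtain c where c: "c \<in> B" "f c k \<noteq> 0" by auto
    define g where "g b i = f b i - f b k / f c k * f c i" for b i
    have "finite (B - {c})" "k < card (B - {c})" using Suc.prems c by auto
    from Suc.IH[OF this, of g] obtain a where
      a: "\<exists>b\<in>B - {c}. a b \<noteq> 0" "\<And>i. i < k \<Longrightarrow> (\<Sum>b\<in>B - {c}. a b * g b i) = 0" by blast
    \<comment> \<open>The weight of the pivot is chosen to kill coordinate \<open>k\<close>.\<close>
    define s where "s = - (\<Sum>b\<in>B - {c}. a b * f b k) / f c k"
    define a' where "a' = a(c := s)"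
    have split: "(\<Sum>b\<in>B. a' b * f b i) = s * f c i + (\<Sum>b\<in>B - {c}. a b * f b i)" for i
      using Suc.prems c by (subst sum.remove[of _ c]) (auto simp: a'_def intro!: sum.cong)
    have g: "(\<Sum>b\<in>B - {c}. a b * f b i) = (\<Sum>b\<in>B - {c}. a b * g b i) - s * f c i" for i
      by (simp add: g_def s_def algebra_simps sum_subtractf sum_divide_distrib sum_distrib_left sum_distrib_right)
    have "(\<Sum>b\<in>B. a' b * f b i) = 0" if "i < Suc k" for i
    proof (cases "i = k")
      case True then show ?thesis using c by (simp only: split) (simp add: s_def)
    next
      case False then show ?thesis using that a(2)[of i] by (simp only: split g) simp
    qed
    moreover have "\<exists>b\<in>B. a' b \<noteq> 0" using a(1) by (auto simp: a'_def)
    ultimately show ?thesis by blast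
  qed
qed

section \<open>Intersection multiplicity as contact order\<close>

text \<open>The point is cut out by the lines \<open>L\<close> and \<open>M\<close>, and \<open>w\<close> does not vanish there. The equation
  \<open>F = U L + V M\<close> with \<open>U(P) \<noteq> 0\<close> expresses that \<open>F\<close> is smooth at \<open>P\<close> with tangent different from
  \<open>M = 0\<close>, so that \<open>M / w\<close> is a uniformizer of the curve; the arc is parametrized by \<open>\<beta> t = M / w\<close>.
  The arc need only lie on the curve up to order \<open>N\<close>, so a truncated Taylor expansion will do. The
  factor \<open>c0\<close> allows any homogeneous coordinates of \<open>P\<close> as starting point.\<close>
locale contact_arc =
  fixes P :: proj_plane and \<gamma> :: "complex poly ^ 3" and F w L M U V :: tpoly
    and e N :: nat and \<beta> c0 :: complex
  assumes start: "coords P = c0 *s arc_at \<gamma> 0"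
    and frame: "\<And>i. \<exists>a b c. tvar i = tconst a * w + tconst b * L + tconst c * M"
    and lines: "homogeneous 1 w" "homogeneous 1 L" "homogeneous 1 M"
    and curve_eq: "F = U * L + V * M"
    and cofactors: "homogeneous e U" "homogeneous e V" "\<not> vanishes_at U P"
    and on_lines: "vanishes_at L P" "vanishes_at M P"
    and pull_w: "pull \<gamma> w = 1"
    and pull_M: "pull \<gamma> M = monom \<beta> 1" "\<beta> \<noteq> 0"
    and pull_F: "monom 1 N dvd pull \<gamma> F"
begin

lemma c0_nonzero: "c0 \<noteq> 0"
  using start coords_nonzero[of P] by auto

lemma vanishes_iff: "homogeneous d A \<Longrightarrow> vanishes_at A P \<longleftrightarrow> coeff (pull \<gamma> A) 0 = 0"
  using c0_nonzero by (simp add: vanishes_at_def start teval_scale poly_0_coeff_0[symmetric])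

lemma w_nonzero: "\<not> vanishes_at w P"
  using vanishes_iff[OF lines(1)] by (simp add: pull_w)

lemma pull_M_power: "pull \<gamma> M ^ m = monom (\<beta> ^ m) m"
  by (induction m) (simp_all add: pull_M(1) mult_monom)

text \<open>Taylor expansion at \<open>P\<close> to first order. Homogeneity is asserted for \<open>w A1\<close> and \<open>w A2\<close> and not
  for the cofactors themselves: this avoids the degree \<open>d - 1\<close>, which is wrong at \<open>d = 0\<close>, and it is
  enough because \<open>w\<close> is a unit at \<open>P\<close>.\<close>
lemma frame_decomposition:
  assumes "homogeneous d A"
  obtains k A1 A2 where "A = tconst k * w ^ d + A1 * L + A2 * M"
    "homogeneous d (w * A1)" "homogeneous d (w * A2)"
proof -
  have "homogeneous d A \<and> (\<exists>k A1 A2. A = tconst k * w ^ d + A1 * L + A2 * M \<and>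
           homogeneous d (w * A1) \<and> homogeneous d (w * A2))"
    using assms
  proof (induction rule: homogeneous_induct)
    case (zero d)
    have "(0 :: tpoly) = tconst 0 * w ^ d + 0 * L + 0 * M" by (simp add: tconst_def)
    then show ?case by (metis homogeneous_0 mult_zero_right)
  next
    case (add d A B)
    then obtain k A1 A2 l B1 B2 where
      A: "A = tconst k * w ^ d + A1 * L + A2 * M" "homogeneous d (w * A1)" "homogeneous d (w * A2)" and
      B: "B = tconst l * w ^ d + B1 * L + B2 * M" "homogeneous d (w * B1)" "homogeneous d (w * B2)"
      by blast
    have "A + B = tconst (k + l) * w ^ d + (A1 + B1) * L + (A2 + B2) * M"
      by (rule teval_eqI) (simp add: A(1) B(1) algebra_simps)
    moreover have "homogeneous d (w * (A1 + B1))" "homogeneous d (w * (A2 + B2))"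
      by (simp_all add: distrib_left homogeneous_add A B)
    ultimately show ?case using add homogeneous_add by blast
  next
    case (mult d e A B)
    then obtain k A1 A2 l B1 B2 where
      A: "A = tconst k * w ^ d + A1 * L + A2 * M" "homogeneous d (w * A1)" "homogeneous d (w * A2)" and
      B: "B = tconst l * w ^ e + B1 * L + B2 * M" "homogeneous e (w * B1)" "homogeneous e (w * B2)"
      by blast
    have "A * B = tconst (k * l) * w ^ (d + e)
        + (tconst k * w ^ d * B1 + A1 * B) * L + (tconst k * w ^ d * B2 + A2 * B) * M"
      by (rule teval_eqI) (simp add: A(1) B(1) algebra_simps power_add)
    moreover have "homogeneous (d + e) (w * (tconst k * w ^ d * C1 + C2 * B))"
      if "homogeneous e (w * C1)" "homogeneous d (w * C2)" for C1 C2
    proof -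
      have "homogeneous (d + e) (tconst k * w ^ d * (w * C1) + (w * C2) * B)"
        using that mult homogeneous_power[OF lines(1), of d]
        by (intro homogeneous_add homogeneous_mult homogeneous_tconst_mult) auto
      then show ?thesis by (simp add: algebra_simps)
    qed
    ultimately show ?case using A B mult homogeneous_mult by blast
  next
    case (const c)
    have "tconst c = tconst c * w ^ 0 + 0 * L + 0 * M" by simp
    then show ?case by (metis homogeneous_0 mult_zero_right homogeneous_tconst)
  next
    case (var i)
    obtain a b c where "tvar i = tconst a * w ^ 1 + tconst b * L + tconst c * M"
      using frame[of i] by auto
    moreover have "homogeneous 1 (w * tconst x)" for x
      using lines(1) by (simp add: mult.commute[of w] homogeneous_tconst_mult)
    ultimately show ?case using homogeneous_tvar by blast
  qed
  with that show ?thesis by blast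
qed

lemma vanishing_form:
  assumes "homogeneous d A" "vanishes_at A P"
  obtains A1 A2 where "A = A1 * L + A2 * M" "homogeneous d (w * A1)" "homogeneous d (w * A2)"
proof -
  obtain k A1 A2 where A: "A = tconst k * w ^ d + A1 * L + A2 * M"
    "homogeneous d (w * A1)" "homogeneous d (w * A2)"
    using frame_decomposition[OF assms(1)] .
  have "k = 0" using assms(2) on_lines w_nonzero by (auto simp: A(1) vanishes_at_def)
  with A have "A = A1 * L + A2 * M" by (simp add: tconst_def)
  with A show thesis using that by blast
qed

text \<open>Each step divides by one more factor \<open>M\<close>. By the contact hypothesis the remaining cofactor
  \<open>A'\<close> vanishes at \<open>P\<close>, hence \<open>A' = A1 L + A2 M\<close>; multiplication by the unit \<open>U\<close> turns \<open>U L\<close> into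
  \<open>F - V M\<close>. The order \<open>m\<close> must not exceed \<open>N\<close>, since beyond that order \<open>F\<close> itself is visible along
  the arc.\<close>
lemma factor_uniformizer:
  assumes "homogeneous d A" "m \<le> N" "monom 1 m dvd pull \<gamma> A"
  shows "\<exists>d1 d2 B S A'. homogeneous d1 B \<and> \<not> vanishes_at B P \<and> homogeneous d2 A' \<and>
           B * A = S * F + M ^ m * A'"
  using assms(2,3)
proof (induction m)
  case 0
  have "\<not> vanishes_at 1 P" by (simp add: vanishes_at_def)
  moreover have "1 * A = 0 * F + M ^ 0 * A" by simp
  ultimately show ?case using assms(1) homogeneous_1 by blast
next
  case (Suc m)
  have "monom (1 :: complex) m dvd monom 1 (Suc m)" by (simp add: monom_1_dvd_iff')
  with Suc have "m \<le> N" "monom 1 m dvd pull \<gamma> A" by (auto intro: dvd_trans)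
  from Suc.IH[OF this] obtain d1 d2 B S A' where
    B: "homogeneous d1 B" "\<not> vanishes_at B P" "homogeneous d2 A'" "B * A = S * F + M ^ m * A'"
    by blast
  have "monom 1 (Suc m) dvd pull \<gamma> F"
    using pull_F Suc.prems(1) by (auto simp: monom_1_dvd_iff')
  then have "monom 1 (Suc m) dvd pull \<gamma> B * pull \<gamma> A - pull \<gamma> S * pull \<gamma> F"
    using Suc.prems(2) by (intro dvd_diff dvd_mult)
  also have "\<dots> = monom (\<beta> ^ m) m * pull \<gamma> A'"
    using arg_cong[OF B(4), of "pull \<gamma>"] by (simp add: pull_M_power algebra_simps)
  finally have "coeff (monom (\<beta> ^ m) m * pull \<gamma> A') m = 0" by (simp add: monom_1_dvd_iff')
  then have "vanishes_at A' P"
    using pull_M vanishes_iff[OF B(3)] by (simp add: coeff_monom_mult)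
  then obtain A1 A2 where A': "A' = A1 * L + A2 * M"
      "homogeneous d2 (w * A1)" "homogeneous d2 (w * A2)"
    using vanishing_form[OF B(3)] by blast
  \<comment> \<open>The factor \<open>w\<close> is there only to restore homogeneity of the new cofactor.\<close>
  have "(w * U * B) * A = (w * U * S + M ^ m * w * A1) * F + M ^ Suc m * (U * (w * A2) - (w * A1) * V)"
    using B(4) by (simp add: mult.assoc) (simp add: A'(1) curve_eq algebra_simps)
  moreover have "homogeneous (e + d2) (U * (w * A2) - (w * A1) * V)"
    using homogeneous_mult[OF cofactors(1) A'(3)] homogeneous_mult[OF A'(2) cofactors(2)]
    by (simp add: homogeneous_diff add.commute)
  moreover have "homogeneous (1 + e + d1) (w * U * B)"
    using lines cofactors B by (intro homogeneous_mult) auto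
  moreover have "\<not> vanishes_at (w * U * B) P"
    using w_nonzero cofactors B by (simp add: vanishes_at_def)
  ultimately show ?case by blast
qed

text \<open>The Taylor series of an element of the local ring along the arc. As a relation it needs no
  proof that the series is independent of the chosen fraction.\<close>
definition arc_value :: "tpoly fract \<Rightarrow> complex fps \<Rightarrow> bool" where
  "arc_value r f \<longleftrightarrow> (\<exists>A B d. r = Fract A B \<and> homogeneous d A \<and> homogeneous d B \<and>
     \<not> vanishes_at B P \<and> fps_of_poly (pull \<gamma> B) * f = fps_of_poly (pull \<gamma> A))"

lemma nonvanishing_nonzero: "\<not> vanishes_at B P \<Longrightarrow> B \<noteq> 0"
  by (auto simp: vanishes_at_def)

lemma arc_value_exists:
  assumes "r \<in> local_ring P"
  shows "\<exists>f. arc_value r f"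
proof -
  obtain A B d where r: "r = Fract A B" "homogeneous d A" "homogeneous d B" "\<not> vanishes_at B P"
    using assms unfolding local_ring_def by blast
  have "fps_nth (fps_of_poly (pull \<gamma> B)) 0 \<noteq> 0" using r vanishes_iff by simp
  then have "fps_of_poly (pull \<gamma> B) * (inverse (fps_of_poly (pull \<gamma> B)) * fps_of_poly (pull \<gamma> A))
      = fps_of_poly (pull \<gamma> A)"
    by (simp add: inverse_mult_eq_1' flip: mult.assoc)
  with r show ?thesis unfolding arc_value_def by blast
qed

lemma arc_value_0: "arc_value 0 0"
proof -
  have "0 = Fract 0 (1 :: tpoly)" by (rule Zero_fract_def)
  moreover have "\<not> vanishes_at 1 P" by (simp add: vanishes_at_def)
  ultimately show ?thesis unfolding arc_value_def
    by (intro exI[of _ 0] exI[of _ 1]) auto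
qed

lemma arc_value_add:
  assumes "arc_value r f" "arc_value s g"
  shows "arc_value (r + s) (f + g)"
proof -
  obtain A B d where r: "r = Fract A B" "homogeneous d A" "homogeneous d B" "\<not> vanishes_at B P"
     "fps_of_poly (pull \<gamma> B) * f = fps_of_poly (pull \<gamma> A)"
    using assms unfolding arc_value_def by blast
  obtain A' B' d' where s: "s = Fract A' B'" "homogeneous d' A'" "homogeneous d' B'" "\<not> vanishes_at B' P"
     "fps_of_poly (pull \<gamma> B') * g = fps_of_poly (pull \<gamma> A')"
    using assms unfolding arc_value_def by blast
  have "r + s = Fract (A * B' + A' * B) (B * B')"
    using r s by (simp add: nonvanishing_nonzero)
  moreover have "homogeneous (d + d') (A * B' + A' * B)"
    using homogeneous_mult[OF r(2) s(3)] homogeneous_mult[OF s(2) r(3)]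
    by (simp add: homogeneous_add add.commute)
  moreover have "homogeneous (d + d') (B * B')" using r s by (intro homogeneous_mult)
  moreover have "\<not> vanishes_at (B * B') P" using r s by (simp add: vanishes_at_def)
  moreover have "fps_of_poly (pull \<gamma> (B * B')) * (f + g) = fps_of_poly (pull \<gamma> (A * B' + A' * B))"
    by (simp add: fps_of_poly_add fps_of_poly_mult algebra_simps flip: r(5) s(5))
  ultimately show ?thesis unfolding arc_value_def by blast
qed

lemma arc_value_scale:
  assumes "arc_value r f"
  shows "arc_value (Fract (tconst c) 1 * r) (fps_const c * f)"
proof -
  obtain A B d where r: "r = Fract A B" "homogeneous d A" "homogeneous d B" "\<not> vanishes_at B P"
     "fps_of_poly (pull \<gamma> B) * f = fps_of_poly (pull \<gamma> A)"
    using assms unfolding arc_value_def by blast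
  have "fps_of_poly (pull \<gamma> B) * (fps_const c * f) = fps_of_poly (pull \<gamma> (tconst c * A))"
    using r(5) by (simp add: fps_of_poly_mult algebra_simps fps_of_poly_smult)
  moreover have "Fract (tconst c) 1 * r = Fract (tconst c * A) B" by (simp add: r)
  ultimately show ?thesis using r homogeneous_tconst_mult unfolding arc_value_def by blast
qed

lemma arc_value_combination:
  assumes "\<And>b. b \<in> S \<Longrightarrow> arc_value (h b) (f b)"
  shows "arc_value (\<Sum>b\<in>S. Fract (tconst (a b)) 1 * h b) (\<Sum>b\<in>S. fps_const (a b) * f b)"
  using assms
  by (induction S rule: infinite_finite_induct)
    (auto intro!: arc_value_0 arc_value_add arc_value_scale)

text \<open>Both generators of the ideal vanish to order \<open>n\<close> along the arc and denominators are units there,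
  so the same holds for every element of the ideal.\<close>
lemma contact_of_ideal_member:
  assumes "r \<in> local_ideal P F G" "arc_value r f" "n \<le> N" "monom 1 n dvd pull \<gamma> G" "k < n"
  shows "fps_nth f k = 0"
proof -
  obtain A B d X Y where A: "r = Fract A B" "homogeneous d A" "homogeneous d B" "\<not> vanishes_at B P"
      "A = X * F + Y * G"
    using assms(1) unfolding local_ideal_def by blast
  obtain C D d' where C: "r = Fract C D" "homogeneous d' C" "homogeneous d' D" "\<not> vanishes_at D P"
     "fps_of_poly (pull \<gamma> D) * f = fps_of_poly (pull \<gamma> C)"
    using assms(2) unfolding arc_value_def by blast
  have "A * D = C * B" using A C by (simp add: nonvanishing_nonzero eq_fract)
  then have "pull \<gamma> A * pull \<gamma> D = pull \<gamma> C * pull \<gamma> B" by (metis pull_simps(3))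
  then have "fps_of_poly (pull \<gamma> A) * fps_of_poly (pull \<gamma> D)
      = fps_of_poly (pull \<gamma> D) * f * fps_of_poly (pull \<gamma> B)"
    by (simp add: C(5) flip: fps_of_poly_mult)
  moreover have "fps_of_poly (pull \<gamma> D) \<noteq> 0"
    using C vanishes_iff[OF C(3)] by auto
  ultimately have f: "fps_of_poly (pull \<gamma> A) = fps_of_poly (pull \<gamma> B) * f"
    by (simp add: algebra_simps)
  have "monom 1 n dvd pull \<gamma> F" using pull_F assms(3) by (auto simp: monom_1_dvd_iff')
  then have "monom 1 n dvd pull \<gamma> A" using assms(4) by (auto simp: A(5) intro: dvd_add)
  then have z: "coeff (pull \<gamma> A) k = 0" if "k < n" for k using that by (simp add: monom_1_dvd_iff')
  show ?thesis using assms(5)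
  proof (induction k rule: less_induct)
    case (less k)
    have "0 = fps_nth (fps_of_poly (pull \<gamma> A)) k" using z less.prems by simp
    also have "\<dots> = fps_nth (f * fps_of_poly (pull \<gamma> B)) k" by (simp only: f mult.commute)
    also have "\<dots> = (\<Sum>i\<in>{0..k}. fps_nth f i * coeff (pull \<gamma> B) (k - i))" by (simp add: fps_mult_nth)
    also have "\<dots> = (\<Sum>i\<in>{k}. fps_nth f i * coeff (pull \<gamma> B) (k - i))"
      using less by (intro sum.mono_neutral_right) auto
    finally show ?case using A vanishes_iff[OF A(3)] by simp
  qed
qed

text \<open>The powers \<open>1, u, ..., u\<^sup>n\<^sup>-\<^sup>1\<close> of the uniformizer \<open>u = M / w\<close> are independent modulo the ideal:
  a relation among them has Taylor series divisible by \<open>t\<^sup>n\<close>, but the series of \<open>u\<^sup>i\<close> is a nonzero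
  multiple of \<open>t\<^sup>i\<close>.\<close>
lemma int_mult_lower:
  assumes "homogeneous g G" "n \<le> N" "monom 1 n dvd pull \<gamma> G"
  shows "enat n \<le> int_mult P F G"
proof -
  define u where "u i = Fract (M ^ i) (w ^ i)" for i
  have w: "\<not> vanishes_at (w ^ i) P" for i using w_nonzero by (simp add: vanishes_at_def)
  have hom: "homogeneous i (M ^ i)" "homogeneous i (w ^ i)" for i
    using homogeneous_power[of 1 _ i] lines by auto
  have M: "pull \<gamma> (M ^ i) = monom (\<beta> ^ i) i" for i
    by (simp add: pull_M_power)
  have val: "arc_value (u i) (fps_of_poly (monom (\<beta> ^ i) i))" for i
    unfolding arc_value_def u_def
    by (intro exI[of _ "M ^ i"] exI[of _ "w ^ i"] exI[of _ i])
      (use w hom M in \<open>auto simp: pull_w\<close>)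
  have inj: "inj u"
  proof (rule injI)
    fix i j assume "u i = u j"
    then have "M ^ i * w ^ j = M ^ j * w ^ i" using nonvanishing_nonzero[OF w] by (simp add: u_def eq_fract)
    then have "pull \<gamma> (M ^ i * w ^ j) = pull \<gamma> (M ^ j * w ^ i)" by simp
    then have "monom (\<beta> ^ i) i = monom (\<beta> ^ j) j" using M by (simp add: pull_w)
    then show "i = j" using pull_M(2) by (metis degree_monom_eq power_not_zero)
  qed
  have "indep_mod (local_ideal P F G) (u ` {..<n})"
    unfolding indep_mod_def
  proof (intro allI impI)
    fix a assume "(\<Sum>b\<in>u ` {..<n}. Fract (tconst (a b)) 1 * b) \<in> local_ideal P F G"
    then have J: "(\<Sum>i<n. Fract (tconst (a (u i))) 1 * u i) \<in> local_ideal P F G"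
      using inj by (simp add: sum.reindex inj_on_subset)
    have "fps_nth (\<Sum>i<n. fps_const (a (u i)) * fps_of_poly (monom (\<beta> ^ i) i)) k = 0" if "k < n" for k
      using contact_of_ideal_member[OF J arc_value_combination[OF val] assms(2,3) that] .
    then have "a (u k) = 0" if "k < n" for k
      using that pull_M(2) by (simp add: fps_sum_nth if_distrib if_distribR cong: if_cong)
    then show "\<forall>b\<in>u ` {..<n}. a b = 0" by auto
  qed
  moreover have "u ` {..<n} \<subseteq> local_ring P"
    unfolding local_ring_def u_def using w hom by blast
  ultimately have "enat (card (u ` {..<n})) \<le> int_mult P F G"
    unfolding int_mult_def by (intro SUP_upper) auto
  then show ?thesis using inj by (simp add: card_image inj_on_subset)
qed

text \<open>If \<open>G\<close> has contact order exactly \<open>k\<close>, then \<open>factor_uniformizer\<close> makes \<open>M\<^sup>k\<close> times a unit an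
  element of the ideal. Among more than \<open>k\<close> elements of the local ring some nontrivial combination
  \<open>r\<close> has a Taylor series that starts at order \<open>k\<close>; its numerator is again a multiple of \<open>M\<^sup>k\<close> modulo
  \<open>F\<close> and a unit, so \<open>r\<close> lies in the ideal.\<close>
lemma int_mult_upper:
  assumes "homogeneous g G" "k < N" "monom 1 k dvd pull \<gamma> G" "coeff (pull \<gamma> G) k \<noteq> 0"
  shows "int_mult P F G \<le> enat k"
proof -
  obtain d1 d2 B S A where B: "homogeneous d1 B" "\<not> vanishes_at B P" "homogeneous d2 A"
      "B * G = S * F + M ^ k * A"
    using factor_uniformizer[OF assms(1) _ assms(3)] assms(2) by auto
  have "\<not> vanishes_at A P"
  proof
    assume "vanishes_at A P"
    then have "coeff (pull \<gamma> A) 0 = 0" using vanishes_iff B(3) by simp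
    then have "monom 1 (Suc k) dvd pull \<gamma> (M ^ k * A)"
      by (auto simp: pull_M_power monom_1_dvd_iff' coeff_monom_mult less_Suc_eq)
    moreover have "monom 1 (Suc k) dvd pull \<gamma> F"
      using pull_F assms(2) by (auto simp: monom_1_dvd_iff')
    ultimately have "monom 1 (Suc k) dvd pull \<gamma> (B * G)" by (auto simp: B(4) intro: dvd_add)
    then have "monom 1 (Suc k) dvd pull \<gamma> G * pull \<gamma> B" by (metis pull_simps(3) mult.commute)
    then have "monom 1 (Suc k) dvd pull \<gamma> G"
      by (rule monom_dvd_cancel) (use B vanishes_iff in auto)
    then show False using assms(4) by (simp add: monom_1_dvd_iff')
  qed
  have "card T \<le> k" if T: "finite T" "T \<subseteq> local_ring P" "indep_mod (local_ideal P F G) T" for T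
  proof (rule ccontr)
    assume "\<not> card T \<le> k"
    have "\<forall>b\<in>T. \<exists>f. arc_value b f" using T arc_value_exists by blast
    then obtain f where f: "\<And>b. b \<in> T \<Longrightarrow> arc_value b (f b)" by metis
    obtain a b where a: "b \<in> T" "a b \<noteq> 0" "\<And>i. i < k \<Longrightarrow> (\<Sum>b\<in>T. a b * fps_nth (f b) i) = 0"
      using exists_linear_relation[of T k "\<lambda>b. fps_nth (f b)"] T \<open>\<not> card T \<le> k\<close> by auto
    define r where "r = (\<Sum>b\<in>T. Fract (tconst (a b)) 1 * b)"
    define h where "h = (\<Sum>b\<in>T. fps_const (a b) * f b)"
    have h: "fps_nth h i = 0" if "i < k" for i using a(3)[OF that] by (simp add: h_def fps_sum_nth)
    have "arc_value r h" unfolding r_def h_def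
      using arc_value_combination[where h = "\<lambda>b. b"] f by simp
    then obtain C D d where C: "r = Fract C D" "homogeneous d C" "homogeneous d D" "\<not> vanishes_at D P"
        "fps_of_poly (pull \<gamma> D) * h = fps_of_poly (pull \<gamma> C)"
      unfolding arc_value_def by blast
    have "coeff (pull \<gamma> C) i = 0" if "i < k" for i
    proof -
      have "coeff (pull \<gamma> C) i = fps_nth (fps_of_poly (pull \<gamma> D) * h) i" by (simp add: C(5))
      also have "\<dots> = 0" unfolding fps_mult_nth using h that by (intro sum.neutral) auto
      finally show ?thesis .
    qed
    then have "monom 1 k dvd pull \<gamma> C" by (simp add: monom_1_dvd_iff')
    then obtain d3 d4 B' S' C' where C': "homogeneous d3 B'" "\<not> vanishes_at B' P" "homogeneous d4 C'"
        "B' * C = S' * F + M ^ k * C'"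
      using factor_uniformizer[OF C(2)] assms(2) by (metis less_imp_le)
    have "A * B' * C = A * (S' * F + M ^ k * C')" using C'(4) by (simp add: mult.assoc)
    also have "\<dots> = (A * S') * F + C' * (M ^ k * A)" by (simp add: algebra_simps)
    also have "M ^ k * A = B * G - S * F" using B(4) by simp
    also have "(A * S') * F + C' * (B * G - S * F) = (A * S' - C' * S) * F + (C' * B) * G"
      by (simp add: algebra_simps)
    finally have member: "A * B' * C = (A * S' - C' * S) * F + (C' * B) * G" .
    have "A * B' \<noteq> 0" "D \<noteq> 0"
      using C'(2) C(4) \<open>\<not> vanishes_at A P\<close> nonvanishing_nonzero by auto
    then have "r = Fract (A * B' * C) (A * B' * D)" by (simp add: C(1) eq_fract)
    moreover have "homogeneous (d2 + d3 + d) (A * B' * C)" "homogeneous (d2 + d3 + d) (A * B' * D)"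
      using B C C' by (auto intro!: homogeneous_mult)
    moreover have "\<not> vanishes_at (A * B' * D) P"
      using \<open>\<not> vanishes_at A P\<close> C C' by (simp add: vanishes_at_def)
    ultimately have "r \<in> local_ideal P F G" unfolding local_ideal_def using member by blast
    then show False using T(3) a unfolding indep_mod_def r_def by blast
  qed
  then show ?thesis unfolding int_mult_def by (intro SUP_least) auto
qed

theorem int_mult_ge_iff:
  assumes "homogeneous g G" "n \<le> N"
  shows "enat n \<le> int_mult P F G \<longleftrightarrow> monom 1 n dvd pull \<gamma> G"
proof
  assume n: "enat n \<le> int_mult P F G"
  show "monom 1 n dvd pull \<gamma> G"
  proof (rule ccontr)
    assume "\<not> monom 1 n dvd pull \<gamma> G"
    then obtain j where j: "j < n" "coeff (pull \<gamma> G) j \<noteq> 0" by (auto simp: monom_1_dvd_iff')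
    define k where "k = (LEAST k. coeff (pull \<gamma> G) k \<noteq> 0)"
    have k: "coeff (pull \<gamma> G) k \<noteq> 0" unfolding k_def by (rule LeastI[of _ j]) (rule j)
    have "k \<le> j" unfolding k_def by (rule Least_le) (rule j)
    have "monom 1 k dvd pull \<gamma> G"
      by (auto simp: monom_1_dvd_iff' k_def dest: not_less_Least)
    with k \<open>k \<le> j\<close> j assms have "int_mult P F G \<le> enat k" by (intro int_mult_upper) auto
    with n have "enat n \<le> enat k" by (rule order_trans)
    with \<open>k \<le> j\<close> j show False by simp
  qed
qed (rule int_mult_lower[OF assms])

end

text \<open>The dollar sign is reserved for vector components from here on.\<close>

no_notation fps_nth (infixl \<open>$\<close> 75)

section \<open>Irreducible conics\<close>

definition conic :: "complex \<Rightarrow> complex \<Rightarrow> complex \<Rightarrow> complex \<Rightarrow> complex \<Rightarrow> complex \<Rightarrow> tpoly" where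
  "conic c1 c2 c3 c4 c5 c6 =
     [: [:[:0, 0, c1:], [:0, c4:], [:c2:]:], [:[:0, c5:], [:c6:]:], [:[:c3:]:] :]"

lemma teval_conic:
  "teval (conic c1 c2 c3 c4 c5 c6) v = c1 * (v $ 1)\<^sup>2 + c2 * (v $ 2)\<^sup>2 + c3 * (v $ 3)\<^sup>2
     + c4 * v $ 1 * v $ 2 + c5 * v $ 1 * v $ 3 + c6 * v $ 2 * v $ 3"
  by (simp add: teval_def conic_def algebra_simps power2_eq_square)

lemma coordinate_set:
  fixes i j k :: 3
  assumes "i \<noteq> j" "i \<noteq> k" "j \<noteq> k"
  shows "UNIV = {i, j, k}"
  using assms exhaust_3[of i] exhaust_3[of j] exhaust_3[of k] by (auto simp: UNIV_3)

lemma sum_coordinates: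
  fixes i j k :: 3 and f :: "3 \<Rightarrow> 'a :: comm_monoid_add"
  assumes "i \<noteq> j" "i \<noteq> k" "j \<noteq> k"
  shows "sum f UNIV = f i + f j + f k"
  using assms by (simp add: coordinate_set[OF assms] add.assoc)

text \<open>The induction over forms describes degrees 0, 1 and 2 simultaneously, because a quadratic
  product can arise from any splitting of its degree.\<close>
lemma homogeneous_2_bilinear:
  assumes "homogeneous 2 Q"
  shows "\<exists>q. \<forall>v. teval Q v = (\<Sum>m\<in>UNIV. \<Sum>n\<in>UNIV. q m n * (v $ m * v $ n))"
proof -
  define const where "const A \<longleftrightarrow> (\<exists>c. \<forall>v. teval A v = c)" for A
  define lin where "lin A \<longleftrightarrow> (\<exists>l. \<forall>v. teval A v = (\<Sum>m\<in>UNIV. l m * v $ m))" for A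
  define quad where "quad A \<longleftrightarrow>
    (\<exists>q. \<forall>v. teval A v = (\<Sum>m\<in>UNIV. \<Sum>n\<in>UNIV. q m n * (v $ m * v $ n)))" for A
  have const_quad: "quad (A * B)" if AB: "const A" "quad B" for A B
  proof -
    obtain c q where "\<forall>v. teval A v = c"
      "\<forall>v. teval B v = (\<Sum>m\<in>UNIV. \<Sum>n\<in>UNIV. q m n * (v $ m * v $ n))"
      using AB unfolding const_def quad_def by blast
    then show ?thesis unfolding quad_def
      by (intro exI[of _ "\<lambda>m n. c * q m n"]) (simp add: sum_distrib_left mult.assoc)
  qed
  have const_lin: "lin (A * B)" if AB: "const A" "lin B" for A B
  proof -
    obtain c l where "\<forall>v. teval A v = c" "\<forall>v. teval B v = (\<Sum>m\<in>UNIV. l m * v $ m)"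
      using AB unfolding const_def lin_def by blast
    then show ?thesis unfolding lin_def
      by (intro exI[of _ "\<lambda>m. c * l m"]) (simp add: sum_distrib_left mult.assoc)
  qed
  have lin_lin: "quad (A * B)" if AB: "lin A" "lin B" for A B
  proof -
    obtain l l' where l: "\<And>v. teval A v = (\<Sum>m\<in>UNIV. l m * v $ m)" and
        l': "\<And>v. teval B v = (\<Sum>m\<in>UNIV. l' m * v $ m)"
      using AB unfolding lin_def by blast
    have "teval (A * B) v = (\<Sum>m\<in>UNIV. \<Sum>n\<in>UNIV. l m * l' n * (v $ m * v $ n))" for v
      by (simp only: teval_simps l l' sum_product) (simp only: mult_ac)
    then show ?thesis unfolding quad_def by (intro exI[of _ "\<lambda>m n. l m * l' n"] allI)
  qed
  have "(d = 0 \<longrightarrow> const A) \<and> (d = 1 \<longrightarrow> lin A) \<and> (d = 2 \<longrightarrow> quad A)" if "homogeneous d A" for d A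
    using that
  proof (induction rule: homogeneous_induct)
    case (zero d)
    show ?case unfolding const_def lin_def quad_def
      by (auto intro: exI[of _ "\<lambda>_. 0"] exI[of _ "\<lambda>_ _. 0"])
  next
    case (add d A B)
    have "const (A + B)" if AB: "const A" "const B"
      using AB unfolding const_def by (metis teval_simps(1))
    moreover have "lin (A + B)" if AB: "lin A" "lin B"
    proof -
      obtain l l' where "\<forall>v. teval A v = (\<Sum>m\<in>UNIV. l m * v $ m)" "\<forall>v. teval B v = (\<Sum>m\<in>UNIV. l' m * v $ m)"
        using AB unfolding lin_def by blast
      then show ?thesis unfolding lin_def
        by (intro exI[of _ "\<lambda>m. l m + l' m"]) (simp add: sum.distrib distrib_right)
    qed
    moreover have "quad (A + B)" if AB: "quad A" "quad B"
    proof -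
      obtain q q' where "\<forall>v. teval A v = (\<Sum>m\<in>UNIV. \<Sum>n\<in>UNIV. q m n * (v $ m * v $ n))"
        "\<forall>v. teval B v = (\<Sum>m\<in>UNIV. \<Sum>n\<in>UNIV. q' m n * (v $ m * v $ n))"
        using AB unfolding quad_def by blast
      then show ?thesis unfolding quad_def
        by (intro exI[of _ "\<lambda>m n. q m n + q' m n"]) (simp add: sum.distrib distrib_right)
    qed
    ultimately show ?case using add by blast
  next
    case (mult d e A B)
    have "const (A * B)" if "const A" "const B" using that unfolding const_def by (metis teval_simps(3))
    moreover have "d + e = 1 \<longleftrightarrow> d = 0 \<and> e = 1 \<or> d = 1 \<and> e = 0"
      "d + e = 2 \<longleftrightarrow> d = 0 \<and> e = 2 \<or> d = 1 \<and> e = 1 \<or> d = 2 \<and> e = 0" by auto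
    ultimately show ?case
      using mult const_quad[of A B] const_quad[of B A] const_lin[of A B] const_lin[of B A] lin_lin[of A B]
      by (auto simp: mult.commute[of B])
  next
    case (const c)
    show ?case by (auto simp: const_def)
  next
    case (var i)
    show ?case unfolding lin_def
      by (auto intro!: exI[of _ "\<lambda>m. if m = i then 1 else 0"] simp: mult_delta_left)
  qed
  with assms show ?thesis unfolding quad_def by simp
qed

lemma quadratic_form:
  assumes "homogeneous 2 Q" "i \<noteq> j" "i \<noteq> k" "j \<noteq> k"
  obtains c1 c2 c3 c4 c5 c6 where "\<And>v. teval Q v = c1 * (v $ i)\<^sup>2 + c2 * (v $ j)\<^sup>2 + c3 * (v $ k)\<^sup>2
     + c4 * (v $ i * v $ j) + c5 * (v $ i * v $ k) + c6 * (v $ j * v $ k)"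
proof -
  obtain q where "\<And>v. teval Q v = (\<Sum>m\<in>UNIV. \<Sum>n\<in>UNIV. q m n * (v $ m * v $ n))"
    using homogeneous_2_bilinear[OF assms(1)] by blast
  then have "teval Q v = q i i * (v $ i)\<^sup>2 + q j j * (v $ j)\<^sup>2 + q k k * (v $ k)\<^sup>2
     + (q i j + q j i) * (v $ i * v $ j) + (q i k + q k i) * (v $ i * v $ k)
     + (q j k + q k j) * (v $ j * v $ k)" for v
    by (simp add: sum_coordinates[OF assms(2-4)]) (simp add: algebra_simps power2_eq_square)
  then show ?thesis by (rule that)
qed

lemma linear_poly_form:
  assumes "degree p \<le> 1"
  obtains p0 p1 where "p = [:p0, p1:]"
proof -
  have "p = [:coeff p 0, coeff p 1:]"
    by (rule poly_eqI) (use assms in \<open>auto simp: coeff_pCons coeff_eq_0 split: nat.splits\<close>)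
  then show ?thesis by (rule that)
qed

text \<open>A binary quadratic form that is the square of a polynomial has zero discriminant.\<close>
lemma square_of_binary_quadratic:
  fixes q :: "complex poly poly"
  assumes "q * q = [:[:0, 0, C:], [:0, B:], [:A:]:]"
  shows "B\<^sup>2 = 4 * A * C"
proof -
  have "degree (q * q) \<le> 2" by (simp add: assms)
  then have "degree q \<le> 1" by (cases "q = 0") (auto simp: degree_mult_eq)
  then obtain q0 q1 where q: "q = [:q0, q1:]"
    by (rule linear_poly_form)
  have *: "q0 * q0 = [:0, 0, C:]" "q0 * q1 + q0 * q1 = [:0, B:]" "q1 * q1 = [:A:]"
    using assms by (auto simp: q algebra_simps split: if_splits)
  have "[:0, B:] * [:0, B:] = 4 * ((q0 * q0) * (q1 * q1))"
    by (simp add: algebra_simps flip: *(2))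
  also have "\<dots> = 4 * ([:0, 0, C:] * [:A:])" by (simp only: *)
  finally have "poly ([:0, B:] * [:0, B:]) 1 = poly (4 * ([:0, 0, C:] * [:A:])) 1" by simp
  then show ?thesis by (simp add: power2_eq_square algebra_simps)
qed

text \<open>The expression in the second hypothesis is four times the determinant of the symmetric matrix of
  the conic. The leading coefficient in \<open>z\<close> is a unit, so a proper factorization has two factors
  linear in \<open>z\<close>, and the discriminant with respect to \<open>z\<close> is then a square in \<open>x\<close> and \<open>y\<close>. By
  \<open>square_of_binary_quadratic\<close> the discriminant of that binary form vanishes, and up to a multiple of
  \<open>c3\<close> it is the determinant.\<close>
lemma irreducible_conicI:
  assumes "c3 \<noteq> 0"
    and "4 * c1 * c2 * c3 + c4 * c5 * c6 - c1 * c6\<^sup>2 - c2 * c5\<^sup>2 - c3 * c4\<^sup>2 \<noteq> 0" (is "?D \<noteq> 0")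
  shows "irreducible (conic c1 c2 c3 c4 c5 c6)" (is "irreducible ?Q")
proof (rule irreducibleI)
  define D0 D1 :: "complex poly poly"
    where "D0 = [:[:0, 0, c1:], [:0, c4:], [:c2:]:]" and "D1 = [:[:0, c5:], [:c6:]:]"
  have Q: "?Q = [:D0, D1, [:[:c3:]:]:]" by (simp add: conic_def D0_def D1_def)
  have deg: "degree ?Q = 2" using assms(1) by (simp add: Q)
  then show "?Q \<noteq> 0" by auto
  show "\<not> is_unit ?Q" using deg by (auto simp: is_unit_poly_iff)
  have unit: "is_unit A" if AB: "?Q = A * B" "degree A = 0" for A B
  proof -
    obtain A0 where A: "A = [:A0:]" using AB(2) by (metis degree_eq_zeroE)
    have "coeff ?Q 2 = A0 * coeff B 2" by (simp add: AB(1) A)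
    then have "A0 dvd [:[:c3:]:]" by (simp add: Q numeral_2_eq_2)
    moreover have "is_unit [:[:c3:]:]" using assms(1) by (simp add: is_unit_const_poly_iff dvd_field_iff)
    ultimately have "is_unit A0" by (rule dvd_unit_imp_unit)
    then show ?thesis by (simp add: A is_unit_const_poly_iff)
  qed
  fix A B assume AB: "?Q = A * B"
  show "is_unit A \<or> is_unit B"
  proof (cases "degree A = 0 \<or> degree B = 0")
    case True
    then show ?thesis using unit[of A B] unit[of B A] AB by (auto simp: mult.commute)
  next
    case False
    have "A \<noteq> 0" "B \<noteq> 0" using deg AB by auto
    then have "degree A + degree B = 2" using deg AB by (simp add: degree_mult_eq)
    with False have "degree A = 1" "degree B = 1" by auto
    then obtain A0 A1 B0 B1 where A: "A = [:A0, A1:]" and B: "B = [:B0, B1:]"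
      by (metis linear_poly_form order_refl)
    have *: "D0 = A0 * B0" "D1 = A0 * B1 + A1 * B0" "[:[:c3:]:] = A1 * B1"
      using AB by (auto simp: Q A B algebra_simps split: if_splits)
    define q where "q = A0 * B1 - A1 * B0"
    have "q * q = D1 * D1 - 4 * (A1 * B1) * D0" by (simp add: * q_def algebra_simps)
    also have "\<dots> = D1 * D1 - smult [:4 * c3:] D0" by (simp flip: *(3) add: numeral_poly)
    also have "\<dots> = [:[:0, 0, c5\<^sup>2 - 4 * c1 * c3:], [:0, 2 * c5 * c6 - 4 * c3 * c4:], [:c6\<^sup>2 - 4 * c2 * c3:]:]"
      by (simp add: D0_def D1_def power2_eq_square algebra_simps)
    finally have "(2 * c5 * c6 - 4 * c3 * c4)\<^sup>2 = 4 * (c6\<^sup>2 - 4 * c2 * c3) * (c5\<^sup>2 - 4 * c1 * c3)"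
      by (rule square_of_binary_quadratic)
    \<comment> \<open>The difference of the two sides is \<open>- 16 c3\<close> times the determinant.\<close>
    then have "16 * c3 * ?D = 0" by algebra
    with assms show ?thesis by simp
  qed
qed

text \<open>The criterion treats \<open>z\<close> as the main variable. Requiring all three squares to occur makes it
  applicable for every ordering of the coordinates.\<close>
lemma irreducible_quadratic_form:
  fixes i j k :: 3
  assumes distinct: "i \<noteq> j" "i \<noteq> k" "j \<noteq> k"
    and Q: "\<And>v. teval Q v = c1 * (v $ i)\<^sup>2 + c2 * (v $ j)\<^sup>2 + c3 * (v $ k)\<^sup>2
     + c4 * (v $ i * v $ j) + c5 * (v $ i * v $ k) + c6 * (v $ j * v $ k)"
    and squares: "c1 \<noteq> 0" "c2 \<noteq> 0" "c3 \<noteq> 0"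
    and det: "4 * c1 * c2 * c3 + c4 * c5 * c6 - c1 * c6\<^sup>2 - c2 * c5\<^sup>2 - c3 * c4\<^sup>2 \<noteq> 0"
  shows "irreducible Q"
proof -
  consider "i = 1" "j = 2" "k = 3" | "i = 1" "j = 3" "k = 2" | "i = 2" "j = 1" "k = 3"
    | "i = 2" "j = 3" "k = 1" | "i = 3" "j = 1" "k = 2" | "i = 3" "j = 2" "k = 1"
    using distinct exhaust_3[of i] exhaust_3[of j] exhaust_3[of k] by blast
  then have "Q \<in> {conic c1 c2 c3 c4 c5 c6, conic c1 c3 c2 c5 c4 c6, conic c2 c1 c3 c4 c6 c5,
      conic c3 c1 c2 c5 c6 c4, conic c2 c3 c1 c6 c4 c5, conic c3 c2 c1 c6 c5 c4}"
  proof cases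
    case 1
    then have "Q = conic c1 c2 c3 c4 c5 c6"
      by (intro teval_eqI) (simp add: Q teval_conic algebra_simps)
    then show ?thesis by simp
  next
    case 2
    then have "Q = conic c1 c3 c2 c5 c4 c6"
      by (intro teval_eqI) (simp add: Q teval_conic algebra_simps)
    then show ?thesis by simp
  next
    case 3
    then have "Q = conic c2 c1 c3 c4 c6 c5"
      by (intro teval_eqI) (simp add: Q teval_conic algebra_simps)
    then show ?thesis by simp
  next
    case 4
    then have "Q = conic c3 c1 c2 c5 c6 c4"
      by (intro teval_eqI) (simp add: Q teval_conic algebra_simps)
    then show ?thesis by simp
  next
    case 5
    then have "Q = conic c2 c3 c1 c6 c4 c5"
      by (intro teval_eqI) (simp add: Q teval_conic algebra_simps)
    then show ?thesis by simp
  next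
    case 6
    then have "Q = conic c3 c2 c1 c6 c5 c4"
      by (intro teval_eqI) (simp add: Q teval_conic algebra_simps)
    then show ?thesis by simp
  qed
  moreover have "irreducible (conic c1 c2 c3 c4 c5 c6)" "irreducible (conic c1 c3 c2 c5 c4 c6)"
    "irreducible (conic c2 c1 c3 c4 c6 c5)" "irreducible (conic c3 c1 c2 c5 c6 c4)"
    "irreducible (conic c2 c3 c1 c6 c4 c5)" "irreducible (conic c3 c2 c1 c6 c5 c4)"
    using squares det by (auto intro!: irreducible_conicI simp: algebra_simps)
  ultimately show ?thesis by blast
qed

lemma not_irreducible_common_zero:
  assumes "teval A v = 0" "teval B v = 0"
  shows "\<not> irreducible (A * B)"
proof
  assume "irreducible (A * B)"
  then have "is_unit A \<or> is_unit B" by (auto dest: irreducibleD)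
  then obtain C where "A * C = 1 \<or> B * C = 1" by (metis dvdE)
  then have "teval (A * C) v = 1 \<or> teval (B * C) v = 1" by (metis teval_simps(10))
  with assms show False by simp
qed

section \<open>An arc on the Fermat cubic\<close>

lemma teval_fermat: "teval fermat_cubic v = (\<Sum>m\<in>UNIV. (v $ m) ^ 3)"
  by (simp add: fermat_cubic_def sum_3)

lemma teval_tangent_form:
  "teval (tangent_form fermat_cubic P) v = 3 * (\<Sum>m\<in>UNIV. (coords P $ m)\<^sup>2 * v $ m)"
  by (simp add: tangent_form_def fermat_cubic_derivs sum_3 algebra_simps)

lemma less_6: "n < 6 \<longleftrightarrow> n = 0 \<or> n = 1 \<or> n = 2 \<or> n = 3 \<or> n = 4 \<or> n = (5 :: nat)"
  by auto

text \<open>Homogeneous coordinates of \<open>P\<close> are \<open>(a, b, 1)\<close> in the order \<open>i, j, k\<close>. A point of the cubic has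
  at least two nonzero coordinates, so such a chart always exists. The condition \<open>b \<noteq> 0\<close> says that
  the tangent is not the line \<open>x\<^sub>i = a x\<^sub>k\<close>, which makes \<open>x\<^sub>i\<close> a parameter of the curve.\<close>
locale fermat_chart =
  fixes P :: proj_plane and i j k :: 3 and a b s :: complex
  assumes distinct: "i \<noteq> j" "i \<noteq> k" "j \<noteq> k"
    and coordinates: "coords P $ i = s * a" "coords P $ j = s * b" "coords P $ k = s"
    and nonzero: "s \<noteq> 0" "b \<noteq> 0"
    and on_curve: "b ^ 3 = - (1 + a ^ 3)"
begin

text \<open>With \<open>x\<^sub>i = a + b\<^sup>3 t\<close> the solution of the affine equation is \<open>x\<^sub>j = b (1 + \<eta>(t))\<close>, where
  \<open>\<eta> = - a\<^sup>2 t + a t\<^sup>2 + e3 t\<^sup>3 + e4 t\<^sup>4 + e5 t\<^sup>5 + ...\<close>. The speed \<open>b\<^sup>3\<close> keeps these coefficients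
  polynomial in \<open>a\<close>, because \<open>b\<^sup>3 = - (1 + a\<^sup>3)\<close>.\<close>
definition "e3 = (4 * a ^ 3 - 1) / 3"
definition "e4 = 5 * (a ^ 5 - a\<^sup>2) / 3"
definition "e5 = (6 * a ^ 7 - 14 * a ^ 4 + 2 * a) / 3"

definition fermat_arc :: "complex poly ^ 3" where
  "fermat_arc = (\<chi> m. if m = i then [:a, b ^ 3:]
     else if m = j then smult b [:1, - a\<^sup>2, a, e3, e4, e5:] else 1)"

lemma fermat_arc_nth [simp]:
  "fermat_arc $ i = [:a, b ^ 3:]"
  "fermat_arc $ j = smult b [:1, - a\<^sup>2, a, e3, e4, e5:]"
  "fermat_arc $ k = 1"
  using distinct by (simp_all add: fermat_arc_def)

text \<open>The equation of the tangent, scaled so that along the arc it is exactly the part of \<open>\<eta>\<close> of order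
  at least 2.\<close>
definition T :: tpoly where
  "T = tconst (1 / b) * tvar j - tvar k + tconst (a\<^sup>2 / b ^ 3) * (tvar i - tconst a * tvar k)"

lemma pull_T: "pull fermat_arc T = [:0, 0, a, e3, e4, e5:]"
  using nonzero by (simp add: T_def one_pCons)

lemma fermat_eq: "fermat_cubic = tvar i ^ 3 + tvar j ^ 3 + tvar k ^ 3"
  by (rule teval_eqI) (simp add: teval_fermat sum_coordinates[OF distinct])

lemma tangent_form_eq: "tangent_form fermat_cubic P = tconst (3 * s\<^sup>2 * b ^ 3) * T"
proof (rule teval_eqI)
  fix v
  have "b ^ 3 * teval T v = b\<^sup>2 * v $ j - b ^ 3 * v $ k + a\<^sup>2 * (v $ i - a * v $ k)"
    using nonzero by (simp add: T_def field_simps power2_eq_square power3_eq_cube)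
  also have "\<dots> = b\<^sup>2 * v $ j + (1 + a ^ 3) * v $ k + a\<^sup>2 * (v $ i - a * v $ k)"
    by (simp add: on_curve algebra_simps)
  finally have T: "b ^ 3 * teval T v = a\<^sup>2 * v $ i + b\<^sup>2 * v $ j + v $ k"
    by (simp add: algebra_simps power2_eq_square power3_eq_cube)
  have "teval (tconst (3 * s\<^sup>2 * b ^ 3) * T) v = 3 * s\<^sup>2 * (b ^ 3 * teval T v)" by simp
  also have "\<dots> = teval (tangent_form fermat_cubic P) v"
    by (simp only: T) (simp add: teval_tangent_form sum_coordinates[OF distinct] coordinates power_mult_distrib algebra_simps)
  finally show "teval (tangent_form fermat_cubic P) v = teval (tconst (3 * s\<^sup>2 * b ^ 3) * T) v" ..
qed

lemma pull_fermat: "monom 1 6 dvd pull fermat_arc fermat_cubic"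
proof -
  have e: "3 * e3 = 4 * a ^ 3 - 1" "3 * e4 = 5 * (a ^ 5 - a\<^sup>2)" "3 * e5 = 6 * a ^ 7 - 14 * a ^ 4 + 2 * a"
    by (simp_all add: e3_def e4_def e5_def)
  have "pull fermat_arc fermat_cubic
      = [:a, b ^ 3:] ^ 3 + smult (b ^ 3) ([:1, - a\<^sup>2, a, e3, e4, e5:] ^ 3) + 1"
    by (simp add: fermat_eq smult_power del: smult_pCons)
  also have "\<dots> = [:a, - (1 + a ^ 3):] ^ 3 + smult (- (1 + a ^ 3)) ([:1, - a\<^sup>2, a, e3, e4, e5:] ^ 3) + 1"
    by (simp only: on_curve)
  finally have p: "pull fermat_arc fermat_cubic = \<dots>" .
  show ?thesis
    unfolding monom_1_dvd_iff' less_6 p power3_eq_cube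
    apply (intro allI impI, elim disjE)
         apply (simp_all add: one_pCons eval_nat_numeral)
    subgoal by algebra
    subgoal using e by algebra
    subgoal using e by (intro disjI2) algebra
    subgoal using e by (intro disjI2) algebra
    done
qed

sublocale contact_arc P fermat_arc fermat_cubic
  "tvar k" "tvar j - tconst b * tvar k" "tvar i - tconst a * tvar k"
  "tvar j ^ 2 + tconst b * tvar j * tvar k + tconst (b\<^sup>2) * tvar k ^ 2"
  "tvar i ^ 2 + tconst a * tvar i * tvar k + tconst (a\<^sup>2) * tvar k ^ 2"
  2 6 "b ^ 3" s
proof
  show "coords P = s *s arc_at fermat_arc 0"
  proof (rule vec_eq_iff[THEN iffD2], rule allI)
    fix m
    have "m \<in> {i, j, k}" using coordinate_set[OF distinct] by blast
    then show "coords P $ m = (s *s arc_at fermat_arc 0) $ m"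
      by (auto simp: arc_at_def coordinates)
  qed
next
  fix m
  have "m \<in> {i, j, k}" using coordinate_set[OF distinct] by blast
  moreover have "tvar i = tconst a * tvar k + tconst 0 * (tvar j - tconst b * tvar k)
      + tconst 1 * (tvar i - tconst a * tvar k)"
    "tvar j = tconst b * tvar k + tconst 1 * (tvar j - tconst b * tvar k)
      + tconst 0 * (tvar i - tconst a * tvar k)"
    "tvar k = tconst 1 * tvar k + tconst 0 * (tvar j - tconst b * tvar k)
      + tconst 0 * (tvar i - tconst a * tvar k)"
    by (auto intro: teval_eqI)
  ultimately show "\<exists>x y z. tvar m = tconst x * tvar k + tconst y * (tvar j - tconst b * tvar k)
      + tconst z * (tvar i - tconst a * tvar k)" by blast
next
  show "homogeneous 1 (tvar k)" "homogeneous 1 (tvar j - tconst b * tvar k)"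
    "homogeneous 1 (tvar i - tconst a * tvar k)"
    by (intro homogeneous_diff homogeneous_tconst_mult homogeneous_tvar)+
next
  show "fermat_cubic
    = (tvar j ^ 2 + tconst b * tvar j * tvar k + tconst (b\<^sup>2) * tvar k ^ 2) * (tvar j - tconst b * tvar k)
    + (tvar i ^ 2 + tconst a * tvar i * tvar k + tconst (a\<^sup>2) * tvar k ^ 2) * (tvar i - tconst a * tvar k)"
  proof (rule teval_eqI)
    fix v
    have "v $ i ^ 3 + v $ j ^ 3 + v $ k ^ 3
      = (v $ j ^ 2 + b * v $ j * v $ k + b\<^sup>2 * v $ k ^ 2) * (v $ j - b * v $ k)
      + (v $ i ^ 2 + a * v $ i * v $ k + a\<^sup>2 * v $ k ^ 2) * (v $ i - a * v $ k)"
      using on_curve by algebra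
    then show "teval fermat_cubic v = teval
      ((tvar j ^ 2 + tconst b * tvar j * tvar k + tconst (b\<^sup>2) * tvar k ^ 2) * (tvar j - tconst b * tvar k)
      + (tvar i ^ 2 + tconst a * tvar i * tvar k + tconst (a\<^sup>2) * tvar k ^ 2) * (tvar i - tconst a * tvar k)) v"
      by (simp add: fermat_eq)
  qed
next
  have hom: "homogeneous 2 (tvar m * tvar n)" for m n
    using homogeneous_mult[OF homogeneous_tvar(1) homogeneous_tvar(1)] by (simp add: numeral_2_eq_2)
  show "homogeneous 2 (tvar j ^ 2 + tconst b * tvar j * tvar k + tconst (b\<^sup>2) * tvar k ^ 2)"
    "homogeneous 2 (tvar i ^ 2 + tconst a * tvar i * tvar k + tconst (a\<^sup>2) * tvar k ^ 2)"
    unfolding power2_eq_square[of "tvar _"] mult.assoc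
    by (intro homogeneous_add homogeneous_tconst_mult hom)+
next
  show "\<not> vanishes_at (tvar j ^ 2 + tconst b * tvar j * tvar k + tconst (b\<^sup>2) * tvar k ^ 2) P"
  proof -
    have "(s * b)\<^sup>2 + b * (s * b) * s + b\<^sup>2 * s\<^sup>2 = 3 * (s * b)\<^sup>2"
      by (simp add: power2_eq_square)
    moreover have "3 * (s * b)\<^sup>2 \<noteq> 0" using nonzero by simp
    ultimately have "(s * b)\<^sup>2 + b * (s * b) * s + b\<^sup>2 * s\<^sup>2 \<noteq> 0" by (simp only: not_False_eq_True)
    then show ?thesis by (simp add: vanishes_at_def coordinates)
  qed
next
  show "vanishes_at (tvar j - tconst b * tvar k) P" "vanishes_at (tvar i - tconst a * tvar k) P"
    by (simp_all add: vanishes_at_def coordinates)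
next
  show "pull fermat_arc (tvar k) = 1" by simp
  show "pull fermat_arc (tvar i - tconst a * tvar k) = monom (b ^ 3) 1"
    by (simp add: one_pCons monom_altdef)
  show "b ^ 3 \<noteq> 0" using nonzero by simp
  show "monom 1 6 dvd pull fermat_arc fermat_cubic" by (rule pull_fermat)
qed

lemma point_on_curve: "P \<in> curve fermat_cubic"
  using on_lines by (simp add: curve_def vanishes_at_def curve_eq)

text \<open>Along the arc the tangent form starts with \<open>a t\<^sup>2\<close>.\<close>
lemma flex_iff: "flex fermat_cubic P \<longleftrightarrow> a = 0"
proof -
  have hom: "homogeneous 1 (tangent_form fermat_cubic P)"
    unfolding tangent_form_eq T_def
    by (intro homogeneous_tconst_mult homogeneous_add homogeneous_diff homogeneous_tvar)
  have "flex fermat_cubic P \<longleftrightarrow> enat 3 \<le> int_mult P fermat_cubic (tangent_form fermat_cubic P)"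
    using point_on_curve Suc_ile_eq[of 2]
    by (simp add: flex_def numeral_eq_enat eval_nat_numeral)
  also have "\<dots> \<longleftrightarrow> monom 1 3 dvd pull fermat_arc (tangent_form fermat_cubic P)"
    by (rule int_mult_ge_iff[OF hom]) simp
  also have "pull fermat_arc (tangent_form fermat_cubic P)
      = smult (3 * s\<^sup>2 * b ^ 3) [:0, 0, a, e3, e4, e5:]"
    by (simp add: tangent_form_eq pull_T)
  also have "monom 1 3 dvd \<dots> \<longleftrightarrow> a = 0"
    using nonzero by (auto simp: monom_1_dvd_iff' numeral_3_eq_3 less_Suc_eq)
  finally show ?thesis .
qed

text \<open>The forms \<open>x\<^sub>k\<close>, \<open>x\<^sub>i - a x\<^sub>k\<close> and \<open>T\<close> have order 0, 1 and 2 along the arc unless \<open>P\<close> is a flex, so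
  in this basis the contact conditions on a conic become nearly triangular.\<close>
lemma adapted_conic:
  assumes "homogeneous 2 Q"
  obtains c1 c2 c3 c4 c5 c6 where
    "Q = tconst c1 * tvar k ^ 2 + tconst c2 * ((tvar i - tconst a * tvar k) * tvar k)
       + tconst c3 * (T * tvar k) + tconst c4 * (tvar i - tconst a * tvar k) ^ 2
       + tconst c5 * ((tvar i - tconst a * tvar k) * T) + tconst c6 * T ^ 2"
proof -
  obtain q1 q2 q3 q4 q5 q6 where
    Q: "\<And>v. teval Q v = q1 * (v $ i)\<^sup>2 + q2 * (v $ j)\<^sup>2 + q3 * (v $ k)\<^sup>2
     + q4 * (v $ i * v $ j) + q5 * (v $ i * v $ k) + q6 * (v $ j * v $ k)"
    using quadratic_form[OF assms distinct] by metis
  \<comment> \<open>The slope of the tangent, from \<open>x\<^sub>j = b (T + x\<^sub>k) + r (x\<^sub>i - a x\<^sub>k)\<close>.\<close>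
  define r where "r = - (a\<^sup>2 / b\<^sup>2)"
  define c1 c2 c3 c4 c5 c6 where c: "c1 = q1 * a\<^sup>2 + q2 * b\<^sup>2 + q3 + q4 * a * b + q5 * a + q6 * b"
    "c2 = 2 * q1 * a + 2 * q2 * b * r + q4 * (b + a * r) + q5 + q6 * r"
    "c3 = 2 * q2 * b\<^sup>2 + q4 * a * b + q6 * b"
    "c4 = q1 + q2 * r\<^sup>2 + q4 * r"
    "c5 = 2 * q2 * b * r + q4 * b"
    "c6 = q2 * b\<^sup>2"
  show thesis
  proof (rule that[of c1 c2 c3 c4 c5 c6], rule teval_eqI)
    fix v
    define x y where "x = v $ i - a * v $ k" and "y = teval T v"
    have "v $ i = x + a * v $ k" by (simp add: x_def)
    moreover have "v $ j = b * (y + v $ k) + r * x"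
      using nonzero by (simp add: y_def x_def T_def r_def field_simps power2_eq_square power3_eq_cube)
    ultimately have "teval Q v = q1 * (x + a * v $ k)\<^sup>2 + q2 * (b * (y + v $ k) + r * x)\<^sup>2 + q3 * (v $ k)\<^sup>2
     + q4 * ((x + a * v $ k) * (b * (y + v $ k) + r * x)) + q5 * ((x + a * v $ k) * v $ k)
     + q6 * ((b * (y + v $ k) + r * x) * v $ k)" by (simp only: Q)
    also have "\<dots> = c1 * (v $ k)\<^sup>2 + c2 * (x * v $ k) + c3 * (y * v $ k) + c4 * x\<^sup>2 + c5 * (x * y) + c6 * y\<^sup>2"
      unfolding c by algebra
    finally show "teval Q v = teval (tconst c1 * tvar k ^ 2
       + tconst c2 * ((tvar i - tconst a * tvar k) * tvar k)
       + tconst c3 * (T * tvar k) + tconst c4 * (tvar i - tconst a * tvar k) ^ 2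
       + tconst c5 * ((tvar i - tconst a * tvar k) * T) + tconst c6 * T ^ 2) v"
      by (simp add: x_def y_def)
  qed
qed

text \<open>Six vanishing Taylor coefficients give six linear equations for the six coefficients of the conic.
  At a flex they force the conic to be a double tangent line. Elsewhere the first five determine the
  conic from \<open>c3\<close>, and the last one becomes the condition \<open>e5 a\<^sup>2 - 3 a e3 e4 + 2 e3\<^sup>3 = 0\<close>, which is
  Monge's differential equation of the conics written in Taylor coefficients.\<close>
lemma sextactic_necessary:
  assumes "sextactic fermat_cubic P"
  shows "a \<noteq> 0 \<and> (a ^ 3 = 1 \<or> a ^ 3 = b ^ 3 \<or> b ^ 3 = 1)"
proof -
  obtain Q where Q: "homogeneous 2 Q" "irreducible Q" "6 \<le> int_mult P fermat_cubic Q"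
    using assms unfolding sextactic_def irreducible_conic_def by blast
  then have contact: "monom 1 6 dvd pull fermat_arc Q"
    using int_mult_ge_iff[OF Q(1), of 6] by (simp add: numeral_eq_enat)
  obtain c1 c2 c3 c4 c5 c6 where
    Q_eq: "Q = tconst c1 * tvar k ^ 2 + tconst c2 * ((tvar i - tconst a * tvar k) * tvar k)
       + tconst c3 * (T * tvar k) + tconst c4 * (tvar i - tconst a * tvar k) ^ 2
       + tconst c5 * ((tvar i - tconst a * tvar k) * T) + tconst c6 * T ^ 2"
    using adapted_conic[OF Q(1)] .
  have p: "pull fermat_arc Q = [:c1:] + smult c2 [:0, b ^ 3:] + smult c3 [:0, 0, a, e3, e4, e5:]
     + smult c4 ([:0, b ^ 3:] * [:0, b ^ 3:]) + smult c5 ([:0, b ^ 3:] * [:0, 0, a, e3, e4, e5:])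
     + smult c6 ([:0, 0, a, e3, e4, e5:] * [:0, 0, a, e3, e4, e5:])"
    by (simp add: Q_eq pull_T one_pCons power2_eq_square)
  have "\<forall>n\<in>{0, 1, 2, 3, 4, 5}. coeff (pull fermat_arc Q) n = 0"
    using contact by (simp add: monom_1_dvd_iff')
  then have coeffs: "c1 = 0" "c2 = 0" "c3 * a + c4 * (b ^ 3 * b ^ 3) = 0" "c3 * e3 + c5 * b ^ 3 * a = 0"
    "c3 * e4 + c5 * b ^ 3 * e3 + c6 * a\<^sup>2 = 0" "c3 * e5 + c5 * b ^ 3 * e4 + 2 * c6 * a * e3 = 0"
    using nonzero by (simp_all add: p eval_nat_numeral algebra_simps)
  have T0: "teval T (arc_at fermat_arc 0) = 0"
    using pull_T by (metis poly_pull poly_pCons mult_zero_left add_0)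
  have degenerate: False if "c3 = 0" "c4 = 0" "c5 = 0"
  proof -
    have "Q = (tconst c6 * T) * T"
      using that coeffs by (auto simp: Q_eq intro: teval_eqI simp: power2_eq_square)
    then show False using Q(2) not_irreducible_common_zero[of "tconst c6 * T" _ T] T0 by simp
  qed
  have "a \<noteq> 0"
  proof
    assume a: "a = 0"
    then have "e3 = - 1 / 3" "e4 = 0" unfolding e3_def e4_def by (simp_all add: a)
    with a coeffs nonzero have "c4 = 0" "c3 = 0" "c5 = 0" by auto
    with degenerate show False by blast
  qed
  have "c3 \<noteq> 0"
  proof
    assume "c3 = 0"
    with coeffs \<open>a \<noteq> 0\<close> nonzero have "c4 = 0" "c5 = 0" by auto
    with degenerate \<open>c3 = 0\<close> show False by blast
  qed
  have "c3 * (e5 * a\<^sup>2 - 3 * a * e3 * e4 + 2 * e3 ^ 3) = 0"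
    using coeffs(4-6) by algebra
  with \<open>c3 \<noteq> 0\<close> have "e5 * a\<^sup>2 - 3 * a * e3 * e4 + 2 * e3 ^ 3 = 0" by simp
  moreover have "27 * (e5 * a\<^sup>2 - 3 * a * e3 * e4 + 2 * e3 ^ 3)
      = (a ^ 3 - 1) * (2 * a ^ 3 + 1) * (a ^ 3 + 2)"
    unfolding e3_def e4_def e5_def by (simp add: field_simps) algebra
  ultimately have "a ^ 3 - 1 = 0 \<or> 2 * a ^ 3 + 1 = 0 \<or> a ^ 3 + 2 = 0" by simp
  then have "a ^ 3 = 1 \<or> a ^ 3 = b ^ 3 \<or> b ^ 3 = 1"
    unfolding on_curve by (elim disjE) (simp_all add: algebra_simps eq_neg_iff_add_eq_0)
  with \<open>a \<noteq> 0\<close> show ?thesis by blast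
qed

text \<open>In the coordinates \<open>X = x\<^sub>i / a\<close>, \<open>Y = x\<^sub>j / b\<close>, \<open>Z = x\<^sub>k\<close> the cubic is \<open>- 2 X\<^sup>3 + Y\<^sup>3 + Z\<^sup>3\<close> and the
  tangent at \<open>P = (1, 1, 1)\<close> is \<open>T = - 2 X + Y + Z\<close>. On the cubic itself \<open>T\<^sup>3\<close> is divisible by
  \<open>Y + Z\<close>, the tangent at the residual flex \<open>(0, -1, 1)\<close>, and the cofactor is the conic \<open>Q\<close> below.\<close>
lemma sextactic_sufficient:
  assumes "a \<noteq> 0" "b ^ 3 = 1"
  shows "sextactic fermat_cubic P"
proof -
  have a3: "a ^ 3 = - 2" using on_curve assms by (simp add: algebra_simps eq_neg_iff_add_eq_0)
  define Q where "Q = tconst (- 4 / a\<^sup>2) * (tvar i * tvar i) + tconst (1 / b\<^sup>2) * (tvar j * tvar j)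
     + tvar k * tvar k + tconst (2 / (a * b)) * (tvar i * tvar j) + tconst (2 / a) * (tvar i * tvar k)
     + tconst (- 2 / b) * (tvar j * tvar k)"
  have hom: "homogeneous 2 (tvar m * tvar n)" for m n
    using homogeneous_mult[OF homogeneous_tvar(1) homogeneous_tvar(1)] by (simp add: numeral_2_eq_2)
  have homQ: "homogeneous 2 Q"
    unfolding Q_def by (intro homogeneous_add homogeneous_tconst_mult hom)
  have "irreducible Q"
  proof (rule irreducible_quadratic_form[OF distinct])
    show "teval Q v = - 4 / a\<^sup>2 * (v $ i)\<^sup>2 + 1 / b\<^sup>2 * (v $ j)\<^sup>2 + 1 * (v $ k)\<^sup>2
     + 2 / (a * b) * (v $ i * v $ j) + 2 / a * (v $ i * v $ k) + (- 2 / b) * (v $ j * v $ k)" for v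
      by (simp add: Q_def power2_eq_square)
    have "4 * (- 4 / a\<^sup>2) * (1 / b\<^sup>2) * 1 + 2 / (a * b) * (2 / a) * (- 2 / b)
      - (- 4 / a\<^sup>2) * (- 2 / b)\<^sup>2 - 1 / b\<^sup>2 * (2 / a)\<^sup>2 - 1 * (2 / (a * b))\<^sup>2 = - 16 / (a\<^sup>2 * b\<^sup>2)"
      using nonzero assms by (simp add: field_simps power2_eq_square)
    moreover have "- 16 / (a\<^sup>2 * b\<^sup>2) \<noteq> 0" using nonzero assms by simp
    ultimately show "4 * (- 4 / a\<^sup>2) * (1 / b\<^sup>2) * 1 + 2 / (a * b) * (2 / a) * (- 2 / b)
      - (- 4 / a\<^sup>2) * (- 2 / b)\<^sup>2 - 1 / b\<^sup>2 * (2 / a)\<^sup>2 - 1 * (2 / (a * b))\<^sup>2 \<noteq> 0"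
      by (simp only: not_False_eq_True)
  qed (use nonzero assms in auto)
  have key: "3 * teval Q v * (v $ j / b + v $ k) = 4 * teval fermat_cubic v - teval T v ^ 3" for v
  proof -
    define x y where "x = v $ i / a" and "y = v $ j / b"
    have v: "v $ i = a * x" "v $ j = b * y" using nonzero assms by (simp_all add: x_def y_def)
    have "teval T v = y - v $ k + a\<^sup>2 * (a * x - a * v $ k)"
      using nonzero by (simp add: T_def assms v)
    also have "\<dots> = - 2 * x + y + v $ k" using a3 by algebra
    finally have T: "teval T v = - 2 * x + y + v $ k" .
    have Q: "teval Q v = (y - v $ k)\<^sup>2 + 2 * x * (y + v $ k) - 4 * x\<^sup>2"
      using nonzero assms(1) by (simp add: Q_def v field_simps power2_eq_square)
    have F: "teval fermat_cubic v = - 2 * x ^ 3 + y ^ 3 + v $ k ^ 3"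
      by (simp add: fermat_eq v power_mult_distrib a3 assms(2))
    show ?thesis unfolding T Q F y_def[symmetric] by algebra
  qed
  have "Q * (tconst (3 / b) * tvar j + tconst 3 * tvar k) = tconst 4 * fermat_cubic - T ^ 3"
  proof (rule teval_eqI)
    fix v
    show "teval (Q * (tconst (3 / b) * tvar j + tconst 3 * tvar k)) v
        = teval (tconst 4 * fermat_cubic - T ^ 3) v"
      using key[of v] by (simp add: algebra_simps)
  qed
  from arg_cong[OF this, of "pull fermat_arc"]
  have "pull fermat_arc Q * pull fermat_arc (tconst (3 / b) * tvar j + tconst 3 * tvar k)
     = smult 4 (pull fermat_arc fermat_cubic) - pull fermat_arc T ^ 3"
    by simp
  moreover have "monom 1 6 dvd pull fermat_arc T ^ 3"
  proof -
    have "monom 1 2 dvd pull fermat_arc T"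
      by (auto simp: pull_T monom_1_dvd_iff' less_2_cases_iff)
    then have "monom 1 2 ^ 3 dvd pull fermat_arc T ^ 3" by (rule dvd_power_same)
    then show ?thesis by (simp add: monom_power)
  qed
  ultimately have "monom 1 6 dvd
      pull fermat_arc Q * pull fermat_arc (tconst (3 / b) * tvar j + tconst 3 * tvar k)"
    using pull_fermat by (metis dvd_diff dvd_smult)
  then have "monom 1 6 dvd pull fermat_arc Q"
    by (rule monom_dvd_cancel) (use nonzero in simp)
  then have "enat 6 \<le> int_mult P fermat_cubic Q" using int_mult_ge_iff[OF homQ] by simp
  then show ?thesis
    using point_on_curve homQ \<open>irreducible Q\<close>
    unfolding sextactic_def irreducible_conic_def by (auto simp: numeral_eq_enat)
qed

end

section \<open>Flexes, sextactic points and their tangent lines\<close>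

lemma point_eqI:
  assumes "coords P = c *s coords Q"
  shows "P = Q"
proof -
  have "proj_rel (coords P) (coords Q)"
    unfolding proj_rel_def using assms coords_nonzero by blast
  then have "abs_proj_plane (coords P) = abs_proj_plane (coords Q)"
    by (rule Quotient3_rel_abs[OF Quotient3_proj_plane])
  then show ?thesis by (simp add: Quotient3_abs_rep[OF Quotient3_proj_plane])
qed

lemma point_with_coords:
  assumes "v \<noteq> 0"
  obtains P c where "c \<noteq> 0" "coords P = c *s v"
  using coords_abs[OF assms] by blast

lemma mem_fermat_iff: "P \<in> curve fermat_cubic \<longleftrightarrow> (\<Sum>m\<in>UNIV. (coords P $ m) ^ 3) = 0"
  by (simp add: curve_def vanishes_at_def teval_fermat)

lemma mem_tangent_iff:
  "R \<in> tangent_line fermat_cubic P \<longleftrightarrow> (\<Sum>m\<in>UNIV. (coords P $ m)\<^sup>2 * coords R $ m) = 0"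
  by (simp add: tangent_line_def curve_def vanishes_at_def teval_tangent_form)

lemma coords_eqI:
  fixes i j k :: 3 and u v :: "complex ^ 3"
  assumes "i \<noteq> j" "i \<noteq> k" "j \<noteq> k" "u $ i = v $ i" "u $ j = v $ j" "u $ k = v $ k"
  shows "u = v"
  unfolding vec_eq_iff
proof
  fix m
  have "m \<in> {i, j, k}" using coordinate_set[OF assms(1-3)] by blast
  then show "u $ m = v $ m" using assms(4-6) by auto
qed

lemma fermat_chartI:
  fixes i j k :: 3
  assumes "P \<in> curve fermat_cubic" "i \<noteq> j" "i \<noteq> k" "j \<noteq> k" "coords P $ j \<noteq> 0" "coords P $ k \<noteq> 0"
  shows "fermat_chart P i j k (coords P $ i / coords P $ k) (coords P $ j / coords P $ k) (coords P $ k)"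
proof
  have "coords P $ i ^ 3 + coords P $ j ^ 3 + coords P $ k ^ 3 = 0"
    using assms(1) by (simp add: mem_fermat_iff sum_coordinates[OF assms(2-4)])
  then have "coords P $ j ^ 3 = - (coords P $ k ^ 3 + coords P $ i ^ 3)" by algebra
  then show "(coords P $ j / coords P $ k) ^ 3 = - (1 + (coords P $ i / coords P $ k) ^ 3)"
    using assms(6) by (simp add: power_divide field_simps)
qed (use assms in auto)

lemma two_nonzero_coordinates:
  assumes "P \<in> curve fermat_cubic"
  obtains j k where "j \<noteq> k" "coords P $ j \<noteq> 0" "coords P $ k \<noteq> 0"
proof -
  obtain k where k: "coords P $ k \<noteq> 0" using coords_nonzero[of P] by (auto simp: vec_eq_iff)
  have "\<exists>j. j \<noteq> k \<and> coords P $ j \<noteq> 0"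
  proof (rule ccontr)
    assume "\<not> ?thesis"
    then have "(\<Sum>m\<in>UNIV. (coords P $ m) ^ 3) = (\<Sum>m\<in>{k}. (coords P $ m) ^ 3)"
      by (intro sum.mono_neutral_right) auto
    with assms k show False by (simp add: mem_fermat_iff)
  qed
  with k that show ?thesis by blast
qed

lemma third_coordinate:
  fixes j k :: 3
  assumes "j \<noteq> k"
  obtains i where "i \<noteq> j" "i \<noteq> k"
proof -
  have "card {j, k} < card (UNIV :: 3 set)" using assms by simp
  then have "\<exists>i. i \<notin> {j, k}" by (metis UNIV_eq_I less_irrefl)
  with that show ?thesis by blast
qed

lemma other_coordinates:
  fixes i :: 3
  obtains j k where "i \<noteq> j" "i \<noteq> k" "j \<noteq> k"
proof -
  have "i = 1 \<or> i = 2 \<or> i = 3" by (rule exhaust_3)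
  then show ?thesis using that[of 2 3] that[of 1 3] that[of 1 2] by auto
qed

lemma flex_fermat_iff:
  "flex fermat_cubic P \<longleftrightarrow> P \<in> curve fermat_cubic \<and> (\<exists>m. coords P $ m = 0)"
proof (cases "P \<in> curve fermat_cubic")
  case True
  then obtain j k where jk: "j \<noteq> k" "coords P $ j \<noteq> 0" "coords P $ k \<noteq> 0"
    using two_nonzero_coordinates by metis
  obtain i where i: "i \<noteq> j" "i \<noteq> k" using third_coordinate[OF jk(1)] by metis
  interpret fermat_chart P i j k "coords P $ i / coords P $ k" "coords P $ j / coords P $ k" "coords P $ k"
    using fermat_chartI[OF True i jk] .
  have "m = i" if "coords P $ m = 0" for m
    using coordinate_set[OF distinct] jk that by blast
  then show ?thesis using flex_iff True jk by auto
qed (simp add: flex_def)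

lemma sextactic_fermatD:
  assumes "sextactic fermat_cubic P"
  shows "coords P $ m \<noteq> 0"
    and "\<exists>i j k. i \<noteq> j \<and> i \<noteq> k \<and> j \<noteq> k \<and> coords P $ j ^ 3 = coords P $ k ^ 3"
proof -
  have P: "P \<in> curve fermat_cubic" using assms by (simp add: sextactic_def)
  then obtain j k where jk: "j \<noteq> k" "coords P $ j \<noteq> 0" "coords P $ k \<noteq> 0"
    using two_nonzero_coordinates by metis
  obtain i where i: "i \<noteq> j" "i \<noteq> k" using third_coordinate[OF jk(1)] by metis
  interpret fermat_chart P i j k "coords P $ i / coords P $ k" "coords P $ j / coords P $ k" "coords P $ k"
    using fermat_chartI[OF P i jk] .
  note * = sextactic_necessary[OF assms]
  have "m \<in> {i, j, k}" using coordinate_set[OF distinct] by blast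
  with * jk show "coords P $ m \<noteq> 0" by auto
  from * jk have "coords P $ i ^ 3 = coords P $ k ^ 3 \<or> coords P $ i ^ 3 = coords P $ j ^ 3
      \<or> coords P $ j ^ 3 = coords P $ k ^ 3"
    by (auto simp: power_divide)
  then show "\<exists>i j k. i \<noteq> j \<and> i \<noteq> k \<and> j \<noteq> k \<and> coords P $ j ^ 3 = coords P $ k ^ 3"
    using i jk(1) by metis
qed

lemma sextactic_fermatI:
  fixes i j k :: 3
  assumes "P \<in> curve fermat_cubic" "i \<noteq> j" "i \<noteq> k" "j \<noteq> k"
    and "coords P $ i \<noteq> 0" "coords P $ k \<noteq> 0" "coords P $ j ^ 3 = coords P $ k ^ 3"
  shows "sextactic fermat_cubic P"
proof -
  have "coords P $ j \<noteq> 0" using assms(6,7) by auto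
  with assms interpret fermat_chart P i j k "coords P $ i / coords P $ k" "coords P $ j / coords P $ k" "coords P $ k"
    by (intro fermat_chartI)
  show ?thesis by (rule sextactic_sufficient) (use assms in \<open>auto simp: power_divide\<close>)
qed

text \<open>Write the coordinates of a point as multiples \<open>x\<close>, \<open>y\<close>, \<open>t\<close> of those of \<open>P\<close>. On the tangent
  \<open>t = 2 x - y\<close>, and the cubic restricts to \<open>6 x (x - y)\<^sup>2\<close>: the double root is \<open>P\<close>, and the simple
  root has a zero coordinate and is therefore a flex.\<close>
lemma sextactic_residual_flex:
  assumes "sextactic fermat_cubic P"
  shows "\<exists>R. residual_point fermat_cubic P R \<and> flex fermat_cubic R"
proof -
  define p where "p = coords P"
  obtain i j k where distinct: "i \<noteq> j" "i \<noteq> k" "j \<noteq> k" and jk: "p $ j ^ 3 = p $ k ^ 3"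
    using sextactic_fermatD(2)[OF assms] p_def by blast
  have nz: "p $ m \<noteq> 0" for m using sextactic_fermatD(1)[OF assms] by (simp add: p_def)
  note sums = sum_coordinates[OF distinct]
  have P: "P \<in> curve fermat_cubic" using assms by (simp add: sextactic_def)
  then have pi: "p $ i ^ 3 = - 2 * p $ k ^ 3"
    using jk by (simp add: mem_fermat_iff sums p_def) algebra
  define r :: "complex ^ 3" where "r = (\<chi> m. if m = i then 0 else if m = j then - p $ j else p $ k)"
  have r: "r $ i = 0" "r $ j = - p $ j" "r $ k = p $ k" using distinct by (auto simp: r_def)
  have "r \<noteq> 0" using nz r(3) by auto
  then obtain R c where R: "c \<noteq> 0" "coords R = c *s r" by (rule point_with_coords)
  have on_F: "R \<in> curve fermat_cubic"
    using jk by (simp add: mem_fermat_iff sums R r power_mult_distrib)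
  have on_T: "R \<in> tangent_line fermat_cubic P"
  proof -
    have "p $ j ^ 2 * (- p $ j) + p $ k ^ 2 * p $ k = 0" using jk by algebra
    then have "c * (p $ j ^ 2 * (- p $ j) + p $ k ^ 2 * p $ k) = 0" by simp
    then show ?thesis by (simp add: mem_tangent_iff sums R r algebra_simps flip: p_def)
  qed
  have P_on_T: "P \<in> tangent_line fermat_cubic P"
    using P by (simp add: mem_tangent_iff mem_fermat_iff power2_eq_square power3_eq_cube)
  have "Z = P \<or> Z = R" if Z: "Z \<in> curve fermat_cubic" "Z \<in> tangent_line fermat_cubic P" for Z
  proof -
    define x y t where "x = coords Z $ i / p $ i" "y = coords Z $ j / p $ j" "t = coords Z $ k / p $ k"
    have z: "coords Z $ i = p $ i * x" "coords Z $ j = p $ j * y" "coords Z $ k = p $ k * t"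
      using nz by (simp_all add: x_y_t_def)
    have "p $ k ^ 3 * (- 2 * x ^ 3 + y ^ 3 + t ^ 3) = 0"
    proof -
      have "(p $ i * x) ^ 3 + (p $ j * y) ^ 3 + (p $ k * t) ^ 3 = 0"
        using Z(1) by (simp add: mem_fermat_iff sums z)
      then show ?thesis using pi jk by algebra
    qed
    then have cubic: "- 2 * x ^ 3 + y ^ 3 + t ^ 3 = 0" using nz by simp
    have "p $ k ^ 3 * (- 2 * x + y + t) = 0"
    proof -
      have "p $ i ^ 2 * (p $ i * x) + p $ j ^ 2 * (p $ j * y) + p $ k ^ 2 * (p $ k * t) = 0"
        using Z(2) by (simp add: mem_tangent_iff sums z flip: p_def)
      then show ?thesis using pi jk by algebra
    qed
    then have "- 2 * x + y + t = 0" using nz by simp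
    then have t: "t = 2 * x - y" by algebra
    have "6 * x * (x - y)\<^sup>2 = 0" using cubic unfolding t by algebra
    then consider "x = 0" | "x = y" by auto
    then show ?thesis
    proof cases
      case 1
      have "coords Z = (- y / c) *s coords R"
        by (rule coords_eqI[OF distinct]) (use R r z t 1 in auto)
      then show ?thesis using point_eqI by blast
    next
      case 2
      have "coords Z = x *s coords P"
        by (rule coords_eqI[OF distinct]) (use z t 2 p_def in auto)
      then show ?thesis using point_eqI by blast
    qed
  qed
  moreover have "R \<noteq> P" using r(1) R nz[of i] by (auto simp: p_def)
  ultimately have "residual_point fermat_cubic P R"
    unfolding residual_point_def using P P_on_T on_F on_T by auto
  moreover have "flex fermat_cubic R"
    unfolding flex_fermat_iff using on_F R r(1) by (auto intro!: exI[of _ i])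
  ultimately show ?thesis by blast
qed

text \<open>For the flex \<open>(0, r, 1)\<close> the tangency condition at \<open>(x, y, 1)\<close> reads \<open>y\<^sup>2 r = - 1 = r\<^sup>3\<close>, so
  \<open>y = r\<close>, which gives the flex itself, or \<open>y = - r\<close>, which gives \<open>x\<^sup>3 = - 2\<close>. The three tangents are
  distinct because \<open>x\<close> can be recovered from \<open>x\<^sup>2\<close> and \<open>x\<^sup>3\<close>.\<close>
lemma flex_sextactic_tangents:
  assumes "flex fermat_cubic Q"
  shows "card {l. Q \<in> l \<and> (\<exists>P. sextactic fermat_cubic P \<and> l = tangent_line fermat_cubic P)} = 3"
    (is "card ?lines = 3")
proof -
  define q where "q = coords Q"
  obtain i where i: "q $ i = 0" using assms unfolding flex_fermat_iff q_def by blast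
  obtain j k where distinct: "i \<noteq> j" "i \<noteq> k" "j \<noteq> k" by (rule other_coordinates)
  note sums = sum_coordinates[OF distinct]
  have "q $ j ^ 3 + q $ k ^ 3 = 0"
    using assms i by (simp add: flex_fermat_iff mem_fermat_iff sums q_def)
  moreover have "\<not> (q $ j = 0 \<and> q $ k = 0)"
    using coords_eqI[OF distinct, of q 0] i coords_nonzero[of Q] by (auto simp: q_def)
  ultimately have qk: "q $ k \<noteq> 0" by auto
  define r where "r = q $ j / q $ k"
  have qj: "q $ j = r * q $ k" using qk by (simp add: r_def)
  have "q $ k ^ 3 * (r ^ 3 + 1) = 0"
    using \<open>q $ j ^ 3 + q $ k ^ 3 = 0\<close> unfolding qj by algebra
  then have r3: "r ^ 3 = - 1" using qk by (simp add: eq_neg_iff_add_eq_0)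
  define v :: "complex \<Rightarrow> complex ^ 3" where "v x = (\<chi> m. if m = i then x else if m = j then - r else 1)" for x
  have v: "v x $ i = x" "v x $ j = - r" "v x $ k = 1" for x using distinct by (auto simp: v_def)
  define pt where "pt x = abs_proj_plane (v x)" for x
  have "\<exists>c. c \<noteq> 0 \<and> coords (pt x) = c *s v x" for x
    unfolding pt_def using v(3)[of x] by (intro coords_abs) auto
  then obtain c where c: "\<And>x. c x \<noteq> 0" "\<And>x. coords (pt x) = c x *s v x" by metis
  have tangent: "R \<in> tangent_line fermat_cubic (pt x) \<longleftrightarrow>
      x\<^sup>2 * coords R $ i + r\<^sup>2 * coords R $ j + coords R $ k = 0" for R x
  proof -
    have "R \<in> tangent_line fermat_cubic (pt x) \<longleftrightarrow>
      (c x)\<^sup>2 * (x\<^sup>2 * coords R $ i + r\<^sup>2 * coords R $ j + coords R $ k) = 0"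
      by (simp add: mem_tangent_iff sums c v power_mult_distrib algebra_simps)
    then show ?thesis using c(1) by simp
  qed
  have "?lines = (\<lambda>x. tangent_line fermat_cubic (pt x)) ` {x. x ^ 3 = - 2}"
  proof (intro equalityI subsetI)
    fix l assume "l \<in> ?lines"
    then obtain P where l: "Q \<in> l" "sextactic fermat_cubic P" "l = tangent_line fermat_cubic P" by blast
    define p where "p = coords P"
    have nz: "p $ m \<noteq> 0" for m using sextactic_fermatD(1)[OF l(2)] by (simp add: p_def)
    define x y where "x = p $ i / p $ k" and "y = p $ j / p $ k"
    have p: "p $ i = x * p $ k" "p $ j = y * p $ k" using nz by (simp_all add: x_def y_def)
    have "p $ i ^ 3 + p $ j ^ 3 + p $ k ^ 3 = 0"
      using l(2) by (simp add: sextactic_def mem_fermat_iff sums p_def)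
    then have "p $ k ^ 3 * (x ^ 3 + y ^ 3 + 1) = 0" unfolding p by algebra
    then have xy: "x ^ 3 + y ^ 3 + 1 = 0" using nz by simp
    have "p $ j ^ 2 * q $ j + p $ k ^ 2 * q $ k = 0"
      using l(1,3) i by (simp add: mem_tangent_iff sums flip: p_def q_def)
    then have "p $ k ^ 2 * q $ k * (y\<^sup>2 * r + 1) = 0" unfolding p qj by algebra
    then have "y\<^sup>2 * r + 1 = 0" using nz qk by simp
    then have "r * ((y - r) * (y + r)) = 0" using r3 by algebra
    moreover have "r \<noteq> 0" using r3 by auto
    ultimately consider "y = r" | "y = - r" by (auto simp: eq_neg_iff_add_eq_0)
    then have y: "y = - r"
    proof cases
      case 1
      then have "x ^ 3 = 0" using xy r3 by simp
      then show ?thesis using nz[of i] p(1) by simp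
    qed
    have "x ^ 3 = - 2" using xy r3 unfolding y by algebra
    moreover have "P = pt x"
    proof (rule point_eqI)
      show "coords P = (p $ k / c x) *s coords (pt x)"
        by (rule coords_eqI[OF distinct]) (use c v p y p_def in auto)
    qed
    ultimately show "l \<in> (\<lambda>x. tangent_line fermat_cubic (pt x)) ` {x. x ^ 3 = - 2}" using l by auto
  next
    fix l assume "l \<in> (\<lambda>x. tangent_line fermat_cubic (pt x)) ` {x. x ^ 3 = - 2}"
    then obtain x where x: "x ^ 3 = - 2" "l = tangent_line fermat_cubic (pt x)" by blast
    have "pt x \<in> curve fermat_cubic"
    proof -
      have "(c x) ^ 3 * (x ^ 3 + (- r) ^ 3 + 1) = 0" using x r3 by simp
      then show ?thesis by (simp add: mem_fermat_iff sums c v power_mult_distrib algebra_simps)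
    qed
    then have "sextactic fermat_cubic (pt x)"
      by (rule sextactic_fermatI[OF _ distinct]) (use c v x r3 in \<open>auto simp: power_mult_distrib\<close>)
    moreover have "Q \<in> l"
    proof -
      have "r\<^sup>2 * q $ j + q $ k = 0" using r3 unfolding qj by algebra
      then show ?thesis using i by (simp add: x tangent flip: q_def)
    qed
    ultimately show "l \<in> ?lines" using x by blast
  qed
  moreover have "inj_on (\<lambda>x. tangent_line fermat_cubic (pt x)) {x. x ^ 3 = - 2}"
  proof (rule inj_onI)
    fix x x' assume x: "x \<in> {x. x ^ 3 = - 2}" "x' \<in> {x. x ^ 3 = - 2}"
      and same: "tangent_line fermat_cubic (pt x) = tangent_line fermat_cubic (pt x')"
    \<comment> \<open>The point where the first tangent meets the line \<open>x\<^sub>j = 0\<close>.\<close>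
    define w :: "complex ^ 3" where "w = (\<chi> m. if m = i then 1 else if m = j then 0 else - x\<^sup>2)"
    have w: "w $ i = 1" "w $ j = 0" "w $ k = - x\<^sup>2" using distinct by (auto simp: w_def)
    have "w \<noteq> 0" using w(1) by auto
    then obtain W d where W: "d \<noteq> 0" "coords W = d *s w" by (rule point_with_coords)
    have "W \<in> tangent_line fermat_cubic (pt x)" by (simp add: tangent W w)
    then have "W \<in> tangent_line fermat_cubic (pt x')" using same by simp
    then have "d * (x'\<^sup>2 - x\<^sup>2) = 0" by (simp add: tangent W w algebra_simps)
    then have "x'\<^sup>2 = x\<^sup>2" using W by simp
    moreover have "x' ^ 3 = x ^ 3" "x \<noteq> 0" using x by auto
    ultimately have "x\<^sup>2 * (x' - x) = 0" by algebra
    then show "x = x'" using \<open>x \<noteq> 0\<close> by simp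
  qed
  ultimately have "card ?lines = card {x :: complex. x ^ 3 = - 2}" by (simp add: card_image)
  also have "\<dots> = 3" by (rule card_nth_roots) auto
  finally show ?thesis .
qed

theorem theorem3p1:
  shows "(\<forall>P. sextactic fermat_cubic P \<longrightarrow>
            (\<exists>R. residual_point fermat_cubic P R \<and> flex fermat_cubic R)) \<and>
         (\<forall>Q. flex fermat_cubic Q \<longrightarrow>
            card {l. Q \<in> l \<and> (\<exists>P. sextactic fermat_cubic P \<and> l = tangent_line fermat_cubic P)} = 3)"
  using sextactic_residual_flex flex_sextactic_tangents by blast

end
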